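(* There are infinitely many planar HIST-critical graphs. Moreover, there exist infinitely many planar HIST-critical graphs $G$, each containing an edge $e$ such that $G - e$ is $3$-connected and HIST-critical.
   Context: A HIST of a graph is a spanning tree in which no vertex has degree $2$. A graph is HIST-free if it contains no HIST. A graph $G$ is HIST-critical if it is HIST-free and $G - v$ contains a HIST for every vertex $v$ of $G$. *)

theory Defs
  imports "HOL-Analysis.Analysis"
begin

record 'a graph =
  verts :: "'a set"
  edges :: "'a set set"

definition simple_graph :: "'a graph \<Rightarrow> bool" where
  "simple_graph G \<longleftrightarrow> finite (verts G) \<and> verts G \<noteq> {} \<and>
     (\<forall>e\<in>edges G. e \<subseteq> verts G \<and> card e = 2)"

definition graph_iso :: "'a graph \<Rightarrow> 'b graph \<Rightarrow> bool" where
  "graph_iso G H \<longleftrightarrow> (\<exists>f. bij_betw f (verts G) (verts H) \<and>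
     (\<forall>u\<in>verts G. \<forall>v\<in>verts G. {u, v} \<in> edges G \<longleftrightarrow> {f u, f v} \<in> edges H))"

definition del_verts :: "'a graph \<Rightarrow> 'a set \<Rightarrow> 'a graph" where
  "del_verts G X = \<lparr>verts = verts G - X, edges = {e \<in> edges G. e \<inter> X = {}}\<rparr>"

definition del_edge :: "'a graph \<Rightarrow> 'a set \<Rightarrow> 'a graph" where
  "del_edge G e = \<lparr>verts = verts G, edges = edges G - {e}\<rparr>"

definition degree :: "'a graph \<Rightarrow> 'a \<Rightarrow> nat" where
  "degree G v = card {e \<in> edges G. v \<in> e}"

definition connected_graph :: "'a graph \<Rightarrow> bool" where
  "connected_graph G \<longleftrightarrow> verts G \<noteq> {} \<and>
     (\<forall>u\<in>verts G. \<forall>v\<in>verts G. (u, v) \<in> {(x, y). {x, y} \<in> edges G}\<^sup>*)"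

definition three_connected :: "'a graph \<Rightarrow> bool" where
  "three_connected G \<longleftrightarrow> card (verts G) > 3 \<and>
     (\<forall>X. X \<subseteq> verts G \<and> card X < 3 \<longrightarrow> connected_graph (del_verts G X))"

text \<open>A cycle is given by its cyclic sequence of at least three distinct vertices.\<close>

definition is_cycle :: "'a graph \<Rightarrow> 'a list \<Rightarrow> bool" where
  "is_cycle G c \<longleftrightarrow> length c \<ge> 3 \<and> distinct c \<and>
     (\<forall>i<length c. {c ! i, c ! ((i + 1) mod length c)} \<in> edges G)"

definition tree :: "'a graph \<Rightarrow> bool" where
  "tree T \<longleftrightarrow> simple_graph T \<and> connected_graph T \<and> (\<nexists>c. is_cycle T c)"

definition spanning_tree :: "'a graph \<Rightarrow> 'a graph \<Rightarrow> bool" where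
  "spanning_tree T G \<longleftrightarrow> tree T \<and> verts T = verts G \<and> edges T \<subseteq> edges G"

definition HIST :: "'a graph \<Rightarrow> 'a graph \<Rightarrow> bool" where
  "HIST T G \<longleftrightarrow> spanning_tree T G \<and> (\<forall>v\<in>verts T. degree T v \<noteq> 2)"

definition HIST_free :: "'a graph \<Rightarrow> bool" where
  "HIST_free G \<longleftrightarrow> (\<nexists>T. HIST T G)"

definition HIST_critical :: "'a graph \<Rightarrow> bool" where
  "HIST_critical G \<longleftrightarrow> HIST_free G \<and> (\<forall>v\<in>verts G. \<exists>T. HIST T (del_verts G {v}))"

text \<open>
  A plane drawing, with \<^typ>\<open>complex\<close> as the plane: vertices are distinct points, an edge
  is an arc joining its ends and avoiding all other vertices, and two edges meet at most in
  the points of their common ends.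
\<close>

definition plane_drawing :: "'a graph \<Rightarrow> ('a \<Rightarrow> complex) \<Rightarrow> ('a set \<Rightarrow> real \<Rightarrow> complex) \<Rightarrow> bool" where
  "plane_drawing G p \<gamma> \<longleftrightarrow>
     inj_on p (verts G) \<and>
     (\<forall>e\<in>edges G. arc (\<gamma> e) \<and> {pathstart (\<gamma> e), pathfinish (\<gamma> e)} = p ` e \<and>
        (\<forall>v\<in>verts G. p v \<in> path_image (\<gamma> e) \<longrightarrow> v \<in> e)) \<and>
     (\<forall>e\<in>edges G. \<forall>f\<in>edges G. e \<noteq> f \<longrightarrow>
        path_image (\<gamma> e) \<inter> path_image (\<gamma> f) \<subseteq> p ` (e \<inter> f))"

definition planar :: "'a graph \<Rightarrow> bool" where
  "planar G \<longleftrightarrow> (\<exists>p \<gamma>. plane_drawing G p \<gamma>)"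

text \<open>
  Graphs are counted up to isomorphism. Every finite graph is isomorphic to one with
  vertices in \<^typ>\<open>nat\<close>, so for isomorphism-invariant \<open>P\<close> this choice loses nothing.
\<close>

definition infinitely_many_graphs :: "(nat graph \<Rightarrow> bool) \<Rightarrow> bool" where
  "infinitely_many_graphs P \<longleftrightarrow>
     (\<exists>\<G>. infinite \<G> \<and> (\<forall>G\<in>\<G>. simple_graph G \<and> P G) \<and>
        (\<forall>G\<in>\<G>. \<forall>H\<in>\<G>. graph_iso G H \<longrightarrow> G = H))"

end

theory Submission
  imports Defs
begin

text \<open>
  Let \<open>strip m\<close> consist of a path of hubs $h_0, \ldots, h_m$, a rim cycle $r_0, \ldots, r_{m+1}$ and
  vertices $c_0, \ldots, c_{m-1}$, where $c_i$ is joined to $h_i$, $h_{i+1}$ and $r_{i+1}$, together with the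
  edges $h_0 r_0$ and $h_m r_{m+1}$. For even $m \ge 4$ the graph with the extra edge $e = c_0 c_1$ is the
  example wanted. Its order $3 m + 3$ is odd, so a HIST, having no vertex of degree 2, must have a
  vertex of degree 4 by the handshake lemma. Without $e$ such a vertex is an inner hub using all four
  edges of its two triangles; then the next hub is a leaf or again uses both edges of its
  next triangle, so the tree never leaves the row of triangles and does not span. With $e$ there
  are more cases, all confined to the end of the strip. Conversely, deleting any vertex repairs the
  parity, and suitable trees are written down explicitly.
\<close>

section \<open>Trees given by parent functions\<close>

text \<open>A spanning tree remains one when edges are added on the same vertices. Hence
  HIST-freeness is proved only for the larger graph \<open>chorded_strip m\<close>, while the trees
  after a vertex deletion and 3-connectivity are established only for \<open>strip m\<close>. In
  \<open>strip m\<close> all degrees are 3 except 4 at the inner hubs; the chord \<open>e\<close>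
  adds just c_0 and c_1 as further places for degree 4. Two forcing rules exclude degree 4 in a
  HIST: a vertex whose tree neighbours lie among two candidates is a leaf, and one with three
  candidates has one or all of them; triangles and 4-cycles strike out candidates. Every case ends
  with a set of vertices closed under tree adjacency that misses some vertex. The explicit trees
  cover only part of the deletions, the reflection of the strip gives the rest;
  \<open>m >= 4\<close> is what lets it move the deletion of h_1 to that of h_{m-1} with m - 1 >=
  3.\<close>

lemma sum_degree:
  assumes "simple_graph G"
  shows "(\<Sum>v\<in>verts G. degree G v) = 2 * card (edges G)"
proof -
  have fin: "finite (verts G)" and e: "\<And>e. e \<in> edges G \<Longrightarrow> e \<subseteq> verts G \<and> card e = 2"
    using assms by (auto simp: simple_graph_def)
  have "edges G \<subseteq> Pow (verts G)"
    using e by blast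
  then have finE: "finite (edges G)"
    using fin finite_subset by blast
  have "(\<Sum>v\<in>verts G. card {e \<in> edges G. v \<in> e}) = 2 * card (edges G)"
  proof (rule sum_multicount[OF fin finE])
    show "\<forall>e\<in>edges G. card {v \<in> verts G. v \<in> e} = 2"
    proof
      fix e assume "e \<in> edges G"
      moreover from this have "{v \<in> verts G. v \<in> e} = e"
        using e by blast
      ultimately show "card {v \<in> verts G. v \<in> e} = 2"
        using e by simp
    qed
  qed
  then show ?thesis
    by (simp add: degree_def)
qed

lemma even_order_if_odd_degrees:
  assumes "simple_graph G" "\<And>v. v \<in> verts G \<Longrightarrow> odd (degree G v)"
  shows "even (card (verts G))"
proof -
  have "finite (verts G)"
    using assms(1) by (simp add: simple_graph_def)
  then have "even (\<Sum>v\<in>verts G. degree G v) \<longleftrightarrow> even (card {v \<in> verts G. odd (degree G v)})"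
    by (rule even_sum_iff)
  moreover have "{v \<in> verts G. odd (degree G v)} = verts G"
    using assms(2) by blast
  ultimately show ?thesis
    using sum_degree[OF assms(1)] by simp
qed

lemma degree_eq_card_neighbours:
  assumes "simple_graph G"
  shows "degree G v = card {u. {v, u} \<in> edges G}"
proof -
  have "{e \<in> edges G. v \<in> e} = (\<lambda>u. {v, u}) ` {u. {v, u} \<in> edges G}"
  proof (intro equalityI subsetI)
    fix e assume "e \<in> {e \<in> edges G. v \<in> e}"
    then have e: "e \<in> edges G" "v \<in> e" "card e = 2"
      using assms by (auto simp: simple_graph_def)
    then obtain a b where "e = {a, b}"
      by (auto simp: card_2_iff)
    with e(2) have "e = {v, a} \<or> e = {v, b}"
      by auto
    with e(1) show "e \<in> (\<lambda>u. {v, u}) ` {u. {v, u} \<in> edges G}"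
      by auto
  qed auto
  moreover have "inj_on (\<lambda>u. {v, u}) {u. {v, u} \<in> edges G}"
    by (auto simp: inj_on_def doubleton_eq_iff)
  ultimately show ?thesis
    by (simp add: degree_def card_image)
qed

lemma reachable_sym:
  "(u, v) \<in> {(x, y). {x, y} \<in> E}\<^sup>* \<Longrightarrow> (v, u) \<in> {(x, y). {x, y} \<in> E}\<^sup>*"
proof -
  have "sym {(x, y). {x, y} \<in> E}"
    by (auto simp: sym_def insert_commute)
  then show "(u, v) \<in> {(x, y). {x, y} \<in> E}\<^sup>* \<Longrightarrow> (v, u) \<in> {(x, y). {x, y} \<in> E}\<^sup>*"
    by (meson sym_rtrancl symD)
qed

lemma connected_graph_closed_set:
  assumes "connected_graph G" "x \<in> S" "x \<in> verts G" "y \<in> verts G"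
    and closed: "\<And>u v. u \<in> S \<Longrightarrow> {u, v} \<in> edges G \<Longrightarrow> v \<in> S"
  shows "y \<in> S"
proof -
  have "(x, y) \<in> {(x, y). {x, y} \<in> edges G}\<^sup>*"
    using assms by (simp add: connected_graph_def)
  then show ?thesis
    by (induction rule: rtrancl_induct) (use \<open>x \<in> S\<close> closed in auto)
qed

text \<open>A certificate made of local conditions, checkable for a whole family with parameter
  \<open>m\<close>. The decreasing rank \<open>rk\<close> replaces connectedness and acyclicity. A
  vertex other than the root has its parent as one more neighbour, so it needs zero or at least two
  children; the root needs one or at least three.\<close>

definition rooted_HIST :: "'a graph \<Rightarrow> 'a \<Rightarrow> ('a \<Rightarrow> 'a) \<Rightarrow> ('a \<Rightarrow> nat) \<Rightarrow> bool" where
  "rooted_HIST G r par rk \<longleftrightarrow> r \<in> verts G \<and>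
     (\<forall>x\<in>verts G - {r}. par x \<in> verts G \<and> rk (par x) < rk x \<and> {x, par x} \<in> edges G) \<and>
     (\<forall>x\<in>verts G - {r}. (\<forall>y\<in>verts G - {r}. par y \<noteq> x) \<or>
        (\<exists>a\<in>verts G - {r}. \<exists>b\<in>verts G - {r}. a \<noteq> b \<and> par a = x \<and> par b = x)) \<and>
     ((\<exists>a\<in>verts G - {r}. \<forall>y\<in>verts G - {r}. par y = r \<longleftrightarrow> y = a) \<or>
      (\<exists>a\<in>verts G - {r}. \<exists>b\<in>verts G - {r}. \<exists>c\<in>verts G - {r}.
         a \<noteq> b \<and> a \<noteq> c \<and> b \<noteq> c \<and> par a = r \<and> par b = r \<and> par c = r))"

text \<open>Following parents lowers the rank until the root is reached, which gives connectedness;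
  a cycle fails at its vertex of largest rank.\<close>

lemma HIST_if_rooted_HIST:
  assumes cert: "rooted_HIST G r par rk" and fin: "finite (verts G)"
  shows "\<exists>T. HIST T G"
proof -
  define V where "V = verts G"
  define T where "T = \<lparr>verts = V, edges = (\<lambda>x. {x, par x}) ` (V - {r})\<rparr>"
  have r: "r \<in> V"
    and par: "\<And>x. x \<in> V \<Longrightarrow> x \<noteq> r \<Longrightarrow> par x \<in> V \<and> rk (par x) < rk x \<and> {x, par x} \<in> edges G"
    using cert by (auto simp: rooted_HIST_def V_def)
  have [simp]: "verts T = V"
    by (simp add: T_def)
  have edge_iff: "{x, y} \<in> edges T \<longleftrightarrow> (x \<in> V - {r} \<and> y = par x) \<or> (y \<in> V - {r} \<and> x = par y)" for x y
    unfolding T_def by (auto simp: doubleton_eq_iff)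
  have simple: "simple_graph T"
    unfolding simple_graph_def
  proof (intro conjI ballI)
    fix e assume "e \<in> edges T"
    then obtain x where x: "x \<in> V" "x \<noteq> r" "e = {x, par x}"
      by (auto simp: T_def)
    with par[of x] have "par x \<noteq> x"
      by auto
    with x par[of x] show "e \<subseteq> verts T" "card e = 2"
      by auto
  qed (use fin r in \<open>auto simp: V_def\<close>)
  have to_root: "(x, r) \<in> {(x, y). {x, y} \<in> edges T}\<^sup>*" if "x \<in> V" for x
    using that
  proof (induction "rk x" arbitrary: x rule: less_induct)
    case less
    show ?case
    proof (cases "x = r")
      case False
      then have "{x, par x} \<in> edges T"
        using less.prems by (simp add: edge_iff)
      moreover have "(par x, r) \<in> {(x, y). {x, y} \<in> edges T}\<^sup>*"
        using less False par by blast
      ultimately show ?thesis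
        by (simp add: converse_rtrancl_into_rtrancl)
    qed auto
  qed
  have "connected_graph T"
    unfolding connected_graph_def
  proof (intro conjI ballI)
    fix u v assume "u \<in> verts T" "v \<in> verts T"
    then show "(u, v) \<in> {(x, y). {x, y} \<in> edges T}\<^sup>*"
      by (intro rtrancl_trans[OF to_root reachable_sym[OF to_root]]) simp_all
  qed (use r in auto)
  moreover have "\<not> is_cycle T c" for c
  proof
    assume c: "is_cycle T c"
    define n where "n = length c"
    have n: "n \<ge> 3" and dist: "distinct c"
      and ce: "\<And>i. i < n \<Longrightarrow> {c ! i, c ! ((i + 1) mod n)} \<in> edges T"
      using c by (auto simp: is_cycle_def n_def)
    define M where "M = Max ((\<lambda>i. rk (c ! i)) ` {..<n})"
    have "M \<in> (\<lambda>i. rk (c ! i)) ` {..<n}"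
      unfolding M_def using n by (intro Max_in) (auto simp: lessThan_empty_iff)
    then obtain k where "k < n" "M = rk (c ! k)"
      by auto
    moreover have "rk (c ! i) \<le> M" if "i < n" for i
      unfolding M_def using that by (intro Max_ge) auto
    ultimately have k: "k < n" "\<And>i. i < n \<Longrightarrow> rk (c ! i) \<le> rk (c ! k)"
      by auto
    \<comment> \<open>Both neighbours on the cycle of its vertex of largest rank would be the parent of that vertex.\<close>
    have up: "y = par (c ! k)" if "{c ! k, y} \<in> edges T" "rk y \<le> rk (c ! k)" for y
      using that edge_iff par by force
    \<comment> \<open>Cyclic successor and predecessor of position \<open>k\<close>;
      \<open>n\<close> is added before subtracting 1 so that truncated subtraction does no harm at
      \<open>k = 0\<close>. They differ because \<open>n >= 3\<close>.\<close>
    define s where "s = (k + 1) mod n"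
    define t where "t = (k + n - 1) mod n"
    have st: "s < n" "t < n"
      using n by (auto simp: s_def t_def)
    have t_eq: "t = (if k = 0 then n - 1 else k - 1)"
      using k(1) n by (auto simp: t_def mod_if)
    then have "(t + 1) mod n = k"
      using k(1) n by auto
    with ce[OF st(2)] have "{c ! k, c ! t} \<in> edges T"
      by (simp add: insert_commute)
    then have "c ! t = par (c ! k)"
      using up k st by blast
    moreover have "c ! s = par (c ! k)"
      using up k st ce[OF k(1)] by (simp add: s_def)
    ultimately have "s = t"
      using dist st by (metis n_def nth_eq_iff_index_eq)
    moreover have "s = (if k + 1 = n then 0 else k + 1)"
      using k(1) by (auto simp: s_def)
    ultimately show False
      using t_eq n k(1) by (auto split: if_splits)
  qed
  moreover have "degree T x \<noteq> 2" if x: "x \<in> V" for x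
  proof -
    define N where "N = {y. {x, y} \<in> edges T}"
    have "N \<subseteq> V"
      using edge_iff par by (auto simp: N_def)
    then have finN: "finite N"
      using fin finite_subset by (auto simp: V_def)
    have deg: "degree T x = card N"
      using degree_eq_card_neighbours[OF simple] by (simp add: N_def)
    have three: "card N \<noteq> 2" if "a \<in> N" "b \<in> N" "c \<in> N" "a \<noteq> b" "a \<noteq> c" "b \<noteq> c" for a b c
    proof -
      have "card {a, b, c} \<le> card N"
        using that finN by (intro card_mono) auto
      then show ?thesis
        using that by simp
    qed
    show ?thesis
    proof (cases "x = r")
      case False
      have px: "par x \<in> N"
        using False x by (simp add: N_def edge_iff)
      consider "\<And>y. y \<in> V - {r} \<Longrightarrow> par y \<noteq> x"
        | a b where "a \<in> V - {r}" "b \<in> V - {r}" "a \<noteq> b" "par a = x" "par b = x"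
        using cert False x unfolding rooted_HIST_def V_def by blast
      then show ?thesis
      proof cases
        case 1
        then have "N = {par x}"
          using px by (auto simp: N_def edge_iff)
        then show ?thesis
          by (simp add: deg)
      next
        case 2
        then have "par x \<noteq> a" "par x \<noteq> b"
          using par[of x] par[of a] par[of b] False x by auto
        then show ?thesis
          using three[of "par x" a b] 2 px by (auto simp: deg N_def edge_iff)
      qed
    next
      case True
      have ch: "y \<in> N \<longleftrightarrow> y \<in> V - {r} \<and> par y = r" for y
        using True by (auto simp: N_def edge_iff)
      have "(\<exists>a\<in>V - {r}. \<forall>y\<in>V - {r}. par y = r \<longleftrightarrow> y = a) \<or>
        (\<exists>a\<in>V - {r}. \<exists>b\<in>V - {r}. \<exists>c\<in>V - {r}.
          a \<noteq> b \<and> a \<noteq> c \<and> b \<noteq> c \<and> par a = r \<and> par b = r \<and> par c = r)"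
        using cert unfolding rooted_HIST_def V_def by (elim conjE)
      then consider a where "a \<in> V - {r}" "\<And>y. y \<in> V - {r} \<Longrightarrow> par y = r \<longleftrightarrow> y = a"
        | a b c where "a \<in> V - {r}" "b \<in> V - {r}" "c \<in> V - {r}"
          "a \<noteq> b" "a \<noteq> c" "b \<noteq> c" "par a = r" "par b = r" "par c = r"
        by (elim disjE bexE) auto
      then show ?thesis
      proof cases
        case 1
        then have "N = {a}"
          using ch by blast
        then show ?thesis
          by (simp add: deg)
      next
        case 2
        then show ?thesis
          using three[of a b c] ch by (simp add: deg)
      qed
    qed
  qed
  moreover have "edges T \<subseteq> edges G"
    using par by (auto simp: T_def)
  ultimately have "HIST T G"
    using simple by (auto simp: HIST_def spanning_tree_def tree_def V_def)
  then show ?thesis ..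
qed

text \<open>Meant for a reflection that carries \<open>G\<close> with one vertex deleted to
  \<open>G\<close> with another deleted, so source and target differ. As \<open>f\<close> is its own
  inverse, conjugation needs no second map.\<close>

lemma rooted_HIST_involution:
  assumes cert: "rooted_HIST G r par rk"
    and inv: "\<And>x. x \<in> verts G \<union> verts H \<Longrightarrow> f (f x) = x"
    and vert: "f ` verts G = verts H"
    and edge: "\<And>x y. {x, y} \<in> edges G \<Longrightarrow> {f x, f y} \<in> edges H"
  shows "rooted_HIST H (f r) (f \<circ> par \<circ> f) (rk \<circ> f)"
proof -
  have fG: "f x \<in> verts H" if "x \<in> verts G" for x
    using that vert by blast
  have fH: "f x \<in> verts G" if x: "x \<in> verts H" for x
  proof -
    from x obtain y where "y \<in> verts G" "x = f y"
      using vert by blast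
    then show ?thesis
      using inv by simp
  qed
  have r: "r \<in> verts G"
    using cert by (simp add: rooted_HIST_def)
  have fHr: "f x \<in> verts G - {r}" if "x \<in> verts H - {f r}" for x
    using fH[of x] inv[of x] that by auto
  have fGr: "f x \<in> verts H - {f r}" if "x \<in> verts G - {r}" for x
    using fG[of x] inv[of x] inv[of r] r that by auto
  have par: "par x \<in> verts G" "rk (par x) < rk x" "{x, par x} \<in> edges G" if "x \<in> verts G - {r}" for x
    using cert that by (auto simp: rooted_HIST_def)
  have eq: "f (par (f y)) = x \<longleftrightarrow> par (f y) = f x" if "y \<in> verts H - {f r}" "x \<in> verts H" for x y
    using inv[of "par (f y)"] inv[of x] par(1)[OF fHr[OF that(1)]] that(2) by auto
  show ?thesis
    unfolding rooted_HIST_def o_def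
  proof (intro conjI ballI)
    show "f r \<in> verts H"
      using fG r by blast
  next
    fix x assume x: "x \<in> verts H - {f r}"
    show "f (par (f x)) \<in> verts H"
      using fG[OF par(1)[OF fHr[OF x]]] .
    show "rk (f (f (par (f x)))) < rk (f x)"
      using par[OF fHr[OF x]] inv by simp
    show "{x, f (par (f x))} \<in> edges H"
      using edge[OF par(3)[OF fHr[OF x]]] inv x by simp
  next
    fix x assume x: "x \<in> verts H - {f r}"
    consider "\<And>y. y \<in> verts G - {r} \<Longrightarrow> par y \<noteq> f x"
      | a b where "a \<in> verts G - {r}" "b \<in> verts G - {r}" "a \<noteq> b" "par a = f x" "par b = f x"
      using cert fHr[OF x] unfolding rooted_HIST_def by blast
    then show "(\<forall>y\<in>verts H - {f r}. f (par (f y)) \<noteq> x) \<or>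
      (\<exists>a\<in>verts H - {f r}. \<exists>b\<in>verts H - {f r}. a \<noteq> b \<and> f (par (f a)) = x \<and> f (par (f b)) = x)"
    proof cases
      case 1
      then have "f (par (f y)) \<noteq> x" if "y \<in> verts H - {f r}" for y
        using eq[OF that] fHr[OF that] x by simp
      then show ?thesis
        by blast
    next
      case 2
      then have "f a \<noteq> f b" "f (par (f (f a))) = x" "f (par (f (f b))) = x"
        using inv[of a] inv[of b] inv[of x] x by auto
      then show ?thesis
        using fGr[OF 2(1)] fGr[OF 2(2)] by blast
    qed
  next
    have "(\<exists>a\<in>verts G - {r}. \<forall>y\<in>verts G - {r}. par y = r \<longleftrightarrow> y = a) \<or>
        (\<exists>a\<in>verts G - {r}. \<exists>b\<in>verts G - {r}. \<exists>c\<in>verts G - {r}.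
          a \<noteq> b \<and> a \<noteq> c \<and> b \<noteq> c \<and> par a = r \<and> par b = r \<and> par c = r)"
        using cert unfolding rooted_HIST_def by (elim conjE)
      then consider a where "a \<in> verts G - {r}" "\<And>y. y \<in> verts G - {r} \<Longrightarrow> par y = r \<longleftrightarrow> y = a"
      | a b c where "a \<in> verts G - {r}" "b \<in> verts G - {r}" "c \<in> verts G - {r}"
        "a \<noteq> b" "a \<noteq> c" "b \<noteq> c" "par a = r" "par b = r" "par c = r"
        by (elim disjE bexE) auto
    then show "(\<exists>a\<in>verts H - {f r}. \<forall>y\<in>verts H - {f r}. (f (par (f y)) = f r) = (y = a)) \<or>
      (\<exists>a\<in>verts H - {f r}. \<exists>b\<in>verts H - {f r}. \<exists>c\<in>verts H - {f r}.
        a \<noteq> b \<and> a \<noteq> c \<and> b \<noteq> c \<and> f (par (f a)) = f r \<and> f (par (f b)) = f r \<and> f (par (f c)) = f r)"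
    proof cases
      case 1
      have "(f (par (f y)) = f r) = (y = f a)" if y: "y \<in> verts H - {f r}" for y
      proof -
        have "(f (par (f y)) = f r) = (par (f y) = r)"
          using eq[OF y fG[OF r]] inv r by simp
        also have "\<dots> = (f y = a)"
          using 1 fHr[OF y] by simp
        also have "\<dots> = (y = f a)"
          using inv[of y] inv[of a] y 1(1) by auto
        finally show ?thesis .
      qed
      then show ?thesis
        using fGr[OF 1(1)] by blast
    next
      case 2
      then have "f a \<noteq> f b" "f a \<noteq> f c" "f b \<noteq> f c"
        using inv[of a] inv[of b] inv[of c] by auto
      moreover have "f (par (f (f x))) = f (par x)" if "x \<in> verts G - {r}" for x
        using that inv by simp
      then have "f (par (f (f a))) = f r" "f (par (f (f b))) = f r" "f (par (f (f c))) = f r"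
        using 2 by auto
      ultimately show ?thesis
        using fGr[OF 2(1)] fGr[OF 2(2)] fGr[OF 2(3)] by blast
    qed
  qed
qed

section \<open>Strips of triangles\<close>

text \<open>The three kinds of vertices are coded as the residue classes modulo 3, since
  \<open>infinitely_many_graphs\<close> speaks of graphs on the natural numbers.\<close>

definition Hub :: "nat \<Rightarrow> nat" where "Hub i = 3 * i"
definition Mid :: "nat \<Rightarrow> nat" where "Mid i = 3 * i + 1"
definition Rim :: "nat \<Rightarrow> nat" where "Rim i = 3 * i + 2"

lemma vertex_inject [simp]:
  "Hub i = Hub j \<longleftrightarrow> i = j" "Mid i = Mid j \<longleftrightarrow> i = j" "Rim i = Rim j \<longleftrightarrow> i = j"
  by (auto simp: Hub_def Mid_def Rim_def)

lemma vertex_distinct [simp]: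
  "Hub i \<noteq> Mid j" "Mid j \<noteq> Hub i" "Hub i \<noteq> Rim j" "Rim j \<noteq> Hub i" "Mid i \<noteq> Rim j" "Rim j \<noteq> Mid i"
  unfolding Hub_def Mid_def Rim_def by presburger+

definition vertex_case :: "(nat \<Rightarrow> 'a) \<Rightarrow> (nat \<Rightarrow> 'a) \<Rightarrow> (nat \<Rightarrow> 'a) \<Rightarrow> nat \<Rightarrow> 'a" where
  "vertex_case h c r v =
     (if v mod 3 = 0 then h (v div 3) else if v mod 3 = 1 then c (v div 3) else r (v div 3))"

lemma vertex_case_simps [simp]:
  "vertex_case h c r (Hub i) = h i"
  "vertex_case h c r (Mid i) = c i"
  "vertex_case h c r (Rim i) = r i"
proof -
  have "(3 * i + 1) mod 3 = 1" "(3 * i + 2) mod 3 = 2" "(3 * i + 1) div 3 = i" "(3 * i + 2) div 3 = i"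
    by presburger+
  then show "vertex_case h c r (Hub i) = h i" "vertex_case h c r (Mid i) = c i"
    "vertex_case h c r (Rim i) = r i"
    by (simp_all add: vertex_case_def Hub_def Mid_def Rim_def)
qed

definition strip :: "nat \<Rightarrow> nat graph" where
  "strip m = \<lparr>verts = Hub ` {..m} \<union> Mid ` {..<m} \<union> Rim ` {..Suc m},
     edges = {{Hub i, Hub (Suc i)} |i. i < m} \<union> {{Mid i, Hub i} |i. i < m} \<union>
       {{Mid i, Hub (Suc i)} |i. i < m} \<union> {{Mid i, Rim (Suc i)} |i. i < m} \<union>
       {{Rim i, Rim (Suc i)} |i. i \<le> m} \<union>
       {{Rim 0, Rim (Suc m)}, {Hub 0, Rim 0}, {Hub m, Rim (Suc m)}}\<rparr>"

definition chorded_strip :: "nat \<Rightarrow> nat graph" where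
  "chorded_strip m = \<lparr>verts = verts (strip m), edges = insert {Mid 0, Mid 1} (edges (strip m))\<rparr>"

lemma verts_strip [simp]:
  "Hub i \<in> verts (strip m) \<longleftrightarrow> i \<le> m"
  "Mid i \<in> verts (strip m) \<longleftrightarrow> i < m"
  "Rim i \<in> verts (strip m) \<longleftrightarrow> i \<le> Suc m"
  by (auto simp: strip_def)

lemma verts_strip_cases [consumes 1, case_names Hub Mid Rim]:
  assumes "v \<in> verts (strip m)"
  obtains i where "v = Hub i" "i \<le> m" | i where "v = Mid i" "i < m" | i where "v = Rim i" "i \<le> Suc m"
  using assms by (auto simp: strip_def)

lemma edges_strip [simp]:
  "{Hub i, Hub j} \<in> edges (strip m) \<longleftrightarrow> (j = Suc i \<and> i < m) \<or> (i = Suc j \<and> j < m)"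
  "{Mid i, Hub j} \<in> edges (strip m) \<longleftrightarrow> i < m \<and> (j = i \<or> j = Suc i)"
  "{Hub j, Mid i} \<in> edges (strip m) \<longleftrightarrow> i < m \<and> (j = i \<or> j = Suc i)"
  "{Mid i, Mid j} \<notin> edges (strip m)"
  "{Mid i, Rim j} \<in> edges (strip m) \<longleftrightarrow> i < m \<and> j = Suc i"
  "{Rim j, Mid i} \<in> edges (strip m) \<longleftrightarrow> i < m \<and> j = Suc i"
  "{Hub i, Rim j} \<in> edges (strip m) \<longleftrightarrow> (i = 0 \<and> j = 0) \<or> (i = m \<and> j = Suc m)"
  "{Rim j, Hub i} \<in> edges (strip m) \<longleftrightarrow> (i = 0 \<and> j = 0) \<or> (i = m \<and> j = Suc m)"
  "{Rim i, Rim j} \<in> edges (strip m) \<longleftrightarrow> (j = Suc i \<and> i \<le> m) \<or> (i = Suc j \<and> j \<le> m) \<or>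
     (i = 0 \<and> j = Suc m) \<or> (i = Suc m \<and> j = 0)"
  by (auto simp: strip_def doubleton_eq_iff)

lemma simple_graph_strip: "simple_graph (strip m)"
  unfolding simple_graph_def by (auto simp: strip_def card_insert_if)

lemma card_verts_strip: "card (verts (strip m)) = 3 * m + 3"
proof -
  have "card (Hub ` {..m} \<union> Mid ` {..<m} \<union> Rim ` {..Suc m}) =
      card (Hub ` {..m} \<union> Mid ` {..<m}) + card (Rim ` {..Suc m})"
    by (rule card_Un_disjoint) auto
  moreover have "card (Hub ` {..m} \<union> Mid ` {..<m}) = card (Hub ` {..m}) + card (Mid ` {..<m})"
    by (rule card_Un_disjoint) auto
  ultimately show ?thesis
    by (simp add: strip_def card_image inj_on_def)
qed

text \<open>\<open>branch\<close> marks the vertices meant to have children, and \<open>f\<close>,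
  \<open>g\<close> name two of them. With all these given by \<open>vertex_case\<close>, the
  certificate reduces to a case analysis on the kind of vertex and arithmetic on indices.\<close>

lemma rooted_HISTI:
  assumes "r \<in> verts G"
    and "\<And>x. x \<in> verts G \<Longrightarrow> x \<noteq> r \<Longrightarrow>
      par x \<in> verts G \<and> rk (par x) < rk x \<and> {x, par x} \<in> edges G \<and> (par x = r \<or> branch (par x))"
    and "\<And>x. x \<in> verts G \<Longrightarrow> x \<noteq> r \<Longrightarrow> branch x \<Longrightarrow>
      f x \<in> verts G - {r} \<and> g x \<in> verts G - {r} \<and> f x \<noteq> g x \<and> par (f x) = x \<and> par (g x) = x"
    and "(\<exists>a\<in>verts G - {r}. \<forall>y\<in>verts G - {r}. par y = r \<longleftrightarrow> y = a) \<or>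
      (\<exists>a\<in>verts G - {r}. \<exists>b\<in>verts G - {r}. \<exists>c\<in>verts G - {r}.
         a \<noteq> b \<and> a \<noteq> c \<and> b \<noteq> c \<and> par a = r \<and> par b = r \<and> par c = r)"
  shows "rooted_HIST G r par rk"
  unfolding rooted_HIST_def
proof (intro conjI ballI)
  fix x assume x: "x \<in> verts G - {r}"
  show "(\<forall>y\<in>verts G - {r}. par y \<noteq> x) \<or>
      (\<exists>a\<in>verts G - {r}. \<exists>b\<in>verts G - {r}. a \<noteq> b \<and> par a = x \<and> par b = x)"
  proof (cases "branch x")
    case True
    then show ?thesis
      using assms(3)[of x] x by blast
  next
    case False
    then have "par y \<noteq> x" if "y \<in> verts G - {r}" for y
      using assms(2)[of y] that x by auto
    then show ?thesis
      by blast
  qed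
qed (use assms in auto)

lemma verts_del [simp]: "verts (del_verts G X) = verts G - X"
  and edges_del [simp]: "e \<in> edges (del_verts G X) \<longleftrightarrow> e \<in> edges G \<and> e \<inter> X = {}"
  by (auto simp: del_verts_def)

text \<open>
  In every tree below almost all rim vertices form a path, and \<^term>\<open>Mid i\<close> is either a leaf at
  \<^term>\<open>Rim (Suc i)\<close> or carries the two leaves \<^term>\<open>Hub i\<close> and \<^term>\<open>Hub (Suc i)\<close>. The
  parity of the indices of the second kind is forced by either end of the strip; as \<^term>\<open>m\<close> is
  even the two parities disagree, and the deleted vertex makes up for that.
\<close>

abbreviation cover_odd :: "nat \<Rightarrow> nat" where
  "cover_odd i \<equiv> (if odd i then Mid i else Mid (i - 1))"

abbreviation cover_even :: "nat \<Rightarrow> nat" where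
  "cover_even i \<equiv> (if even i then Mid i else Mid (i - 1))"

text \<open>The deleted hub is where the parity switches: hubs pair up as (0,1), ..., (j-2,j-1)
  before it and as (j+1,j+2), ..., (m-1,m) after it. The rim path starts at the leaf
  \<open>Rim 0\<close> and ends at the leaf \<open>Rim (Suc m)\<close>.\<close>

lemma HIST_del_Hub_even:
  assumes "even m" "even j" "j \<le> m" "m \<ge> 4"
  shows "\<exists>r par rk. rooted_HIST (del_verts (strip m) {Hub j}) r par rk"
proof -
  let ?par = "vertex_case (\<lambda>i. if i < j then cover_even i else cover_odd i)
      (\<lambda>i. Rim (Suc i))
      (\<lambda>i. Rim (i - 1))"
  let ?rk = "vertex_case (\<lambda>i. m + 4) (\<lambda>i. m + 3) (\<lambda>i. i)"
  let ?branch = "vertex_case (\<lambda>i. False) (\<lambda>i. if i < j then even i else odd i) (\<lambda>i. i \<le> m)"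
  let ?f = "vertex_case (\<lambda>i. 0) (\<lambda>i. Hub i) (\<lambda>i. Rim (Suc i))"
  let ?g = "vertex_case (\<lambda>i. 0) (\<lambda>i. Hub (Suc i)) (\<lambda>i. Mid (i - 1))"
  have "rooted_HIST (del_verts (strip m) {Hub j}) (Rim 0) ?par ?rk"
  proof (rule rooted_HISTI[where branch = ?branch and f = ?f and g = ?g], goal_cases)
    case (2 x)
    then have "x \<in> verts (strip m)" by simp
    then show ?case
      by (cases rule: verts_strip_cases; use assms 2 in \<open>(auto elim!: evenE oddE; presburger)\<close>)
  next
    case (3 x)
    then have "x \<in> verts (strip m)" by simp
    then show ?case
      by (cases rule: verts_strip_cases; use assms 3 in \<open>(auto elim!: evenE oddE; presburger)\<close>)
  next
    case 4
    show ?case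
      using assms by (intro disjI1 bexI[of _ "Rim 1"]) (auto elim!: verts_strip_cases split: if_splits)
  qed (use assms in auto)
  then show ?thesis by blast
qed

text \<open>The pairs (1,2), ..., (j-2,j-1) and (j+1,j+2), ..., (m-2,m-1) leave both end hubs over.
  \<open>Hub m\<close> hangs on \<open>Rim (Suc m)\<close>; \<open>Hub 0\<close> and
  \<open>Mid 0\<close> hang on \<open>Hub 1\<close>, which therefore must not be the deleted hub.
  The rim is traversed as 0, m+1, m, ..., 1, so that \<open>Rim (Suc m)\<close> gets a second child
  and \<open>Rim 1\<close>, which has lost \<open>Mid 0\<close>, is the end.\<close>

lemma HIST_del_Hub_odd:
  assumes "even m" "odd j" "3 \<le> j" "j < m"
  shows "\<exists>r par rk. rooted_HIST (del_verts (strip m) {Hub j}) r par rk"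
proof -
  let ?par = "vertex_case (\<lambda>i. if i = 0 then Hub 1 else if i < j then cover_odd i else if i < m then cover_even i else Rim (Suc m))
      (\<lambda>i. if i = 0 then Hub 1 else Rim (Suc i))
      (\<lambda>i. if i \<le> m then Rim (Suc i) else Rim 0)"
  let ?rk = "vertex_case (\<lambda>i. if i = 0 then m + 6 else m + 5) (\<lambda>i. if i = 0 then m + 6 else m + 4) (\<lambda>i. if i = 0 then 0 else m + 2 - i)"
  let ?branch = "vertex_case (\<lambda>i. i = 1) (\<lambda>i. if i < j then odd i else even i) (\<lambda>i. 2 \<le> i)"
  let ?f = "vertex_case (\<lambda>i. Hub 0) (\<lambda>i. Hub i) (\<lambda>i. if i \<le> m then Rim (i - 1) else Rim m)"
  let ?g = "vertex_case (\<lambda>i. Mid 0) (\<lambda>i. Hub (Suc i)) (\<lambda>i. if i \<le> m then Mid (i - 1) else Hub m)"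
  have "rooted_HIST (del_verts (strip m) {Hub j}) (Rim 0) ?par ?rk"
  proof (rule rooted_HISTI[where branch = ?branch and f = ?f and g = ?g], goal_cases)
    case (2 x)
    then have "x \<in> verts (strip m)" by simp
    then show ?case
      by (cases rule: verts_strip_cases; use assms 2 in \<open>(auto elim!: evenE oddE; presburger)\<close>)
  next
    case (3 x)
    then have "x \<in> verts (strip m)" by simp
    then show ?case
      by (cases rule: verts_strip_cases; use assms 3 in \<open>(auto elim!: evenE oddE; presburger)\<close>)
  next
    case 4
    show ?case
      using assms by (intro disjI1 bexI[of _ "Rim (Suc m)"]) (auto elim!: verts_strip_cases split: if_splits)
  qed (use assms in auto)
  then show ?thesis by blast
qed

text \<open>The root \<open>Rim 0\<close> uses all three neighbours, and the rim is cut between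
  \<open>Rim (j + 1)\<close>, whose mid is deleted, and \<open>Rim (j + 2)\<close>, whose mid hangs
  on \<open>Hub (j + 2)\<close> together with \<open>Hub (j + 1)\<close>. Hubs 1, ..., j are paired
  at odd mids and hubs j+2, ..., m-1 at even ones; \<open>Hub m\<close> hangs on
  \<open>Rim (Suc m)\<close>.\<close>

lemma HIST_del_Mid_even:
  assumes "even m" "even j" "j < m" "m \<ge> 4"
  shows "\<exists>r par rk. rooted_HIST (del_verts (strip m) {Mid j}) r par rk"
proof -
  let ?par = "vertex_case (\<lambda>i. if i = 0 then Rim 0 else if i \<le> j then cover_odd i else if i = j + 1 then Hub (j + 2) else if i < m then cover_even i else Rim (Suc m))
      (\<lambda>i. if i = j + 1 then Hub (j + 2) else Rim (Suc i))
      (\<lambda>i. if i \<le> j + 1 then Rim (i - 1) else if i \<le> m then Rim (Suc i) else Rim 0)"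
  let ?rk = "vertex_case (\<lambda>i. if i = j + 1 then m + 6 else m + 5) (\<lambda>i. if i = j + 1 then m + 6 else m + 4) (\<lambda>i. if i \<le> j + 1 then i else m + 2 - i)"
  let ?branch = "vertex_case (\<lambda>i. i = j + 2) (\<lambda>i. if i < j then odd i else even i) (\<lambda>i. (1 \<le> i \<and> i \<le> j) \<or> j + 3 \<le> i)"
  let ?f = "vertex_case (\<lambda>i. Mid (j + 1)) (\<lambda>i. Hub i) (\<lambda>i. if i \<le> j then Rim (i + 1) else Rim (i - 1))"
  let ?g = "vertex_case (\<lambda>i. Hub (j + 1)) (\<lambda>i. Hub (Suc i)) (\<lambda>i. if i \<le> m then Mid (i - 1) else Hub m)"
  have "rooted_HIST (del_verts (strip m) {Mid j}) (Rim 0) ?par ?rk"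
  proof (rule rooted_HISTI[where branch = ?branch and f = ?f and g = ?g], goal_cases)
    case (2 x)
    then have "x \<in> verts (strip m)" by simp
    then show ?case
      by (cases rule: verts_strip_cases; use assms 2 in \<open>(auto elim!: evenE oddE; presburger)\<close>)
  next
    case (3 x)
    then have "x \<in> verts (strip m)" by simp
    then show ?case
      by (cases rule: verts_strip_cases; use assms 3 in \<open>(auto split: if_splits; presburger)\<close>)
  next
    case 4
    show ?case
      using assms by (intro disjI2 bexI[of _ "Rim 1"] bexI[of _ "Rim (Suc m)"] bexI[of _ "Hub 0"]) auto
  qed (use assms in auto)
  then show ?thesis by blast
qed

text \<open>The gap in the rim is bridged along the hubs: \<open>Hub (j - 1)\<close>, ...,
  \<open>Hub (j + 2)\<close> form a path whose first three vertices carry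
  \<open>Mid (j - 1)\<close>, \<open>Mid j\<close>, \<open>Mid (j + 1)\<close> as leaves. This makes
  both rim vertices next to the gap leaves; the other hubs are paired as usual.\<close>

lemma HIST_del_Rim_even:
  assumes "even m" "odd j" "j < m" "m \<ge> 4"
  shows "\<exists>r par rk. rooted_HIST (del_verts (strip m) {Rim (Suc j)}) r par rk"
proof -
  let ?par = "vertex_case (\<lambda>i. if i = 0 then Rim 0 else if i < j then cover_odd i else if i \<le> j + 2 then Hub (i - 1) else if i < m then cover_even i else Rim (Suc m))
      (\<lambda>i. if j \<le> i + 1 \<and> i \<le> j + 1 then Hub i else Rim (Suc i))
      (\<lambda>i. if i \<le> j then Rim (i - 1) else if i \<le> m then Rim (Suc i) else Rim 0)"
  let ?rk = "vertex_case (\<lambda>i. if i < j then m + 5 else m + 6 + i - j) (\<lambda>i. if j \<le> i + 1 \<and> i \<le> j + 1 then m + 10 else m + 4) (\<lambda>i. if i \<le> j then i else m + 2 - i)"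
  \<comment> \<open>If \<open>j + 1 = m\<close>, the hub path already stops at \<open>Hub m\<close>,
    which is then a leaf, and so is \<open>Rim (Suc m)\<close>; this explains the conditions
    comparing with \<open>m\<close>.\<close>
  let ?branch = "vertex_case (\<lambda>i. i + 1 = j \<or> i = j \<or> (i = j + 1 \<and> i < m)) (\<lambda>i. (i + 2 \<le> j \<and> odd i) \<or> (j + 2 \<le> i \<and> even i)) (\<lambda>i. (1 \<le> i \<and> i < j) \<or> (j + 3 \<le> i \<and> j + 1 < m))"
  let ?f = "vertex_case (\<lambda>i. Mid i) (\<lambda>i. Hub i) (\<lambda>i. if i < j then Rim (i + 1) else Rim (i - 1))"
  let ?g = "vertex_case (\<lambda>i. Hub (i + 1)) (\<lambda>i. Hub (Suc i)) (\<lambda>i. if i \<le> m then Mid (i - 1) else Hub m)"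
  have "rooted_HIST (del_verts (strip m) {Rim (Suc j)}) (Rim 0) ?par ?rk"
  proof (rule rooted_HISTI[where branch = ?branch and f = ?f and g = ?g], goal_cases)
    case (2 x)
    then have "x \<in> verts (strip m)" by simp
    then show ?case
      by (cases rule: verts_strip_cases; use assms 2 in \<open>(auto elim!: evenE oddE; presburger)\<close>)
  next
    case (3 x)
    then have "x \<in> verts (strip m)" by simp
    then show ?case
      by (cases rule: verts_strip_cases; use assms 3 in \<open>(auto elim!: evenE oddE; presburger)\<close>)
  next
    case 4
    show ?case
      using assms odd_pos[of j] by (intro disjI2 bexI[of _ "Rim 1"] bexI[of _ "Rim (Suc m)"] bexI[of _ "Hub 0"]) auto
  qed (use assms in auto)
  then show ?thesis by blast
qed

text \<open>The rim path from 1 to m+1 has the odd pairs (1,2), ..., (m-1,m) on it; only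
  \<open>Hub 0\<close> is left over and hangs with \<open>Mid 0\<close> on
  \<open>Hub 1\<close>.\<close>

lemma HIST_del_Rim_0:
  assumes "even m" "m \<ge> 4"
  shows "\<exists>r par rk. rooted_HIST (del_verts (strip m) {Rim 0}) r par rk"
proof -
  let ?par = "vertex_case (\<lambda>i. if i = 0 then Hub 1 else cover_odd i)
      (\<lambda>i. if i = 0 then Hub 1 else Rim (Suc i))
      (\<lambda>i. Rim (i - 1))"
  let ?rk = "vertex_case (\<lambda>i. if i = 0 then m + 6 else m + 5) (\<lambda>i. if i = 0 then m + 6 else m + 4) (\<lambda>i. i)"
  let ?branch = "vertex_case (\<lambda>i. i = 1) (\<lambda>i. odd i) (\<lambda>i. 2 \<le> i \<and> i \<le> m)"
  let ?f = "vertex_case (\<lambda>i. Hub 0) (\<lambda>i. Hub i) (\<lambda>i. Rim (i + 1))"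
  let ?g = "vertex_case (\<lambda>i. Mid 0) (\<lambda>i. Hub (Suc i)) (\<lambda>i. Mid (i - 1))"
  have "rooted_HIST (del_verts (strip m) {Rim 0}) (Rim 1) ?par ?rk"
  proof (rule rooted_HISTI[where branch = ?branch and f = ?f and g = ?g], goal_cases)
    case (2 x)
    then have "x \<in> verts (strip m)" by simp
    then show ?case
      by (cases rule: verts_strip_cases; use assms 2 in \<open>(auto elim!: evenE oddE; presburger)\<close>)
  next
    case (3 x)
    then have "x \<in> verts (strip m)" by simp
    then show ?case
      by (cases rule: verts_strip_cases; use assms 3 in \<open>(auto elim!: evenE oddE; presburger)\<close>)
  next
    case 4
    show ?case
      using assms by (intro disjI1 bexI[of _ "Rim 2"]) (auto elim!: verts_strip_cases split: if_splits)
  qed (use assms in auto)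
  then show ?thesis by blast
qed

section \<open>Reflection of the strip\<close>

definition flip :: "nat \<Rightarrow> nat \<Rightarrow> nat" where
  "flip m = vertex_case (\<lambda>i. Hub (m - i)) (\<lambda>i. Mid (m - 1 - i)) (\<lambda>i. Rim (Suc m - i))"

lemma flip_simps [simp]:
  "flip m (Hub i) = Hub (m - i)" "flip m (Mid i) = Mid (m - 1 - i)" "flip m (Rim i) = Rim (Suc m - i)"
  by (simp_all add: flip_def)

lemma flip_verts: "v \<in> verts (strip m) \<Longrightarrow> flip m v \<in> verts (strip m)"
  and flip_flip: "v \<in> verts (strip m) \<Longrightarrow> flip m (flip m v) = v"
  by (auto elim!: verts_strip_cases)

lemma edge_verts_strip: "{x, y} \<in> edges (strip m) \<Longrightarrow> x \<in> verts (strip m) \<and> y \<in> verts (strip m)"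
  using simple_graph_strip[of m] unfolding simple_graph_def by blast

lemma flip_edges:
  assumes e: "{x, y} \<in> edges (strip m)"
  shows "{flip m x, flip m y} \<in> edges (strip m)"
proof -
  have x: "x \<in> verts (strip m)" and y: "y \<in> verts (strip m)"
    using edge_verts_strip[OF e] by blast+
  from x show ?thesis
    by (cases rule: verts_strip_cases; use y in \<open>cases rule: verts_strip_cases\<close>; use e in auto)
qed

lemma rooted_HIST_flip:
  assumes "rooted_HIST (del_verts (strip m) {v}) r par rk" "v \<in> verts (strip m)"
  shows "\<exists>r par rk. rooted_HIST (del_verts (strip m) {flip m v}) r par rk"
proof -
  have inj: "flip m x = flip m y \<longleftrightarrow> x = y" if "x \<in> verts (strip m)" "y \<in> verts (strip m)" for x y
    using that flip_flip by metis
  have "rooted_HIST (del_verts (strip m) {flip m v}) (flip m r) (flip m \<circ> par \<circ> flip m) (rk \<circ> flip m)"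
  proof (rule rooted_HIST_involution[OF assms(1)])
    show "flip m (flip m x) = x"
      if "x \<in> verts (del_verts (strip m) {v}) \<union> verts (del_verts (strip m) {flip m v})" for x
      using that flip_flip by auto
    show "flip m ` verts (del_verts (strip m) {v}) = verts (del_verts (strip m) {flip m v})"
    proof (intro equalityI subsetI)
      fix x assume x: "x \<in> verts (del_verts (strip m) {flip m v})"
      then have "flip m x \<in> verts (strip m) - {v}"
        using flip_verts flip_flip by auto
      then show "x \<in> flip m ` verts (del_verts (strip m) {v})"
        using flip_flip x by (intro image_eqI[of _ _ "flip m x"]) auto
    qed (use flip_verts inj assms(2) in auto)
    show "{flip m x, flip m y} \<in> edges (del_verts (strip m) {flip m v})"
      if "{x, y} \<in> edges (del_verts (strip m) {v})" for x y
    proof -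
      have "{x, y} \<in> edges (strip m)" "x \<noteq> v" "y \<noteq> v"
        using that by auto
      moreover from this have "flip m x \<noteq> flip m v" "flip m y \<noteq> flip m v"
        using inj edge_verts_strip assms(2) by blast+
      ultimately show ?thesis
        using flip_edges by auto
    qed
  qed
  then show ?thesis by blast
qed

text \<open>For even \<open>m\<close> the reflection preserves the parity of hub indices and changes
  that of mid and rim indices. So even mids, even inner rims and \<open>Rim 0\<close> suffice, while
  for hubs only index 1 has to be reflected.\<close>

lemma HIST_del_strip:
  assumes m: "even m" "m \<ge> 4" and v: "v \<in> verts (strip m)"
  shows "\<exists>T. HIST T (del_verts (strip m) {v})"
proof -
  have "\<exists>r par rk. rooted_HIST (del_verts (strip m) {v}) r par rk"
    using v
  proof (cases rule: verts_strip_cases)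
    case (Hub j)
    consider "even j" | "odd j" "3 \<le> j" | "j = 1"
      by (cases "j \<ge> 3") (auto simp: not_le numeral_3_eq_3 less_Suc_eq)
    then show ?thesis
    proof cases
      case 1
      show ?thesis
        unfolding Hub(1) by (rule HIST_del_Hub_even[OF m(1) 1 Hub(2) m(2)])
    next
      case 2
      then have "j < m"
        using Hub(2) m(1) by (cases "j = m") auto
      then show ?thesis
        unfolding Hub(1) by (rule HIST_del_Hub_odd[OF m(1) 2])
    next
      case 3
      \<comment> \<open>\<open>Hub 1\<close> is the mirror image of \<open>Hub (m - 1)\<close>, to
        which the construction for odd \<open>j >= 3\<close> applies because
        \<open>m >= 4\<close>.\<close>
      have "odd (m - 1)" "3 \<le> m - 1" "m - 1 < m"
        using m by auto
      from HIST_del_Hub_odd[OF m(1) this] have "\<exists>r par rk. rooted_HIST (del_verts (strip m) {flip m (Hub (m - 1))}) r par rk"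
        by (elim exE) (rule rooted_HIST_flip, simp_all)
      then show ?thesis
        using Hub 3 m by simp
    qed
  next
    case (Mid j)
    show ?thesis
    proof (cases "even j")
      case False
      then have "even (m - 1 - j)" "m - 1 - j < m"
        using m Mid by auto
      from HIST_del_Mid_even[OF m(1) this m(2)]
      have "\<exists>r par rk. rooted_HIST (del_verts (strip m) {flip m (Mid (m - 1 - j))}) r par rk"
        by (elim exE) (rule rooted_HIST_flip, use Mid in simp_all)
      then show ?thesis
        using Mid by simp
    qed (use HIST_del_Mid_even Mid m in blast)
  next
    case (Rim k)
    consider "k = 0" | "k = Suc m" | j where "k = Suc j" "odd j" "j < m" | j where "k = Suc j" "even j" "j < m"
      using Rim by (cases k) (auto simp: le_less)
    then show ?thesis
    proof cases
      case 1
      then show ?thesis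
        using HIST_del_Rim_0 Rim m by blast
    next
      case 2
      from HIST_del_Rim_0[OF m] have "\<exists>r par rk. rooted_HIST (del_verts (strip m) {flip m (Rim 0)}) r par rk"
        by (elim exE) (rule rooted_HIST_flip, simp_all)
      then show ?thesis
        using Rim 2 by simp
    next
      case 3
      then show ?thesis
        using HIST_del_Rim_even Rim m by blast
    next
      case 4
      then have "odd (m - 1 - j)" "m - 1 - j < m"
        using m by auto
      from HIST_del_Rim_even[OF m(1) this m(2)]
      have "\<exists>r par rk. rooted_HIST (del_verts (strip m) {flip m (Rim (Suc (m - 1 - j)))}) r par rk"
        by (elim exE) (rule rooted_HIST_flip, use 4 in simp_all)
      moreover have "flip m (Rim (Suc (m - 1 - j))) = v"
        using 4 Rim by simp
      ultimately show ?thesis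
        by simp
    qed
  qed
  moreover have "finite (verts (del_verts (strip m) {v}))"
    using simple_graph_strip[of m] by (simp add: simple_graph_def)
  ultimately show ?thesis
    by (elim exE) (rule HIST_if_rooted_HIST)
qed

section \<open>Absence of a HIST\<close>

lemma edges_chorded_strip [simp]:
  "{x, y} \<in> edges (chorded_strip m) \<longleftrightarrow> {x, y} = {Mid 0, Mid 1} \<or> {x, y} \<in> edges (strip m)"
  by (simp add: chorded_strip_def)

lemma verts_chorded_strip [simp]: "verts (chorded_strip m) = verts (strip m)"
  by (simp add: chorded_strip_def)

locale chorded_strip_HIST =
  fixes m :: nat and T :: "nat graph"
  assumes m: "even m" "m \<ge> 4" and hist: "HIST T (chorded_strip m)"
begin

abbreviation adj :: "nat \<Rightarrow> nat \<Rightarrow> bool" where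
  "adj x y \<equiv> {x, y} \<in> edges T"

lemma T_facts: "simple_graph T" "connected_graph T" "\<not> is_cycle T c" "verts T = verts (strip m)"
  "edges T \<subseteq> edges (chorded_strip m)"
  using hist by (auto simp: HIST_def spanning_tree_def tree_def)

lemma adj_sym: "adj x y \<Longrightarrow> adj y x"
  by (simp add: insert_commute)

lemma adj_neq: "adj x y \<Longrightarrow> x \<noteq> y"
  using T_facts(1) by (force simp: simple_graph_def)

lemma adj_verts: "adj x y \<Longrightarrow> x \<in> verts (strip m) \<and> y \<in> verts (strip m)"
  using T_facts(1,4) by (force simp: simple_graph_def)

section \<open>Forcing rules in a hypothetical HIST\<close>

lemma no_triangle:
  assumes "adj a b" "adj b c" "adj c a"
  shows False
proof -
  have "{[a, b, c] ! i, [a, b, c] ! ((i + 1) mod length [a, b, c])} \<in> edges T" if "i < length [a, b, c]" for i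
  proof -
    have "i = 0 \<or> i = 1 \<or> i = 2"
      using that by auto
    then show ?thesis
      using assms by auto
  qed
  moreover have "distinct [a, b, c]"
    using assms adj_neq[of a b] adj_neq[of b c] adj_neq[of c a] by simp
  ultimately have "is_cycle T [a, b, c]"
    unfolding is_cycle_def by simp
  then show False
    using T_facts(3) by simp
qed

lemma no_square:
  assumes "adj a b" "adj b c" "adj c d" "adj d a" "a \<noteq> c" "b \<noteq> d"
  shows False
proof -
  have "{[a, b, c, d] ! i, [a, b, c, d] ! ((i + 1) mod length [a, b, c, d])} \<in> edges T"
    if "i < length [a, b, c, d]" for i
  proof -
    have "i = 0 \<or> i = 1 \<or> i = 2 \<or> i = 3"
      using that by auto
    then show ?thesis
      using assms by auto
  qed
  moreover have "distinct [a, b, c, d]"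
    using assms adj_neq[of a b] adj_neq[of b c] adj_neq[of c d] adj_neq[of d a] by simp
  ultimately have "is_cycle T [a, b, c, d]"
    unfolding is_cycle_def by simp
  then show False
    using T_facts(3) by simp
qed

lemma neighbour_ex: "v \<in> verts (strip m) \<Longrightarrow> \<exists>u. adj v u"
proof (rule ccontr)
  assume v: "v \<in> verts (strip m)" and no: "\<nexists>u. adj v u"
  obtain w where w: "w \<in> verts (strip m)" "w \<noteq> v"
    by (cases "v = Hub 0") (use that[of "Hub 0"] that[of "Rim 0"] in auto)
  have "w \<in> {v}"
    by (rule connected_graph_closed_set[OF T_facts(2), of v]) (use v w no T_facts(4) in auto)
  then show False
    using w by simp
qed

lemma third_neighbour: "adj v a \<Longrightarrow> adj v b \<Longrightarrow> a \<noteq> b \<Longrightarrow> \<exists>c. adj v c \<and> c \<noteq> a \<and> c \<noteq> b"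
proof (rule ccontr)
  assume a: "adj v a" "adj v b" "a \<noteq> b" and no: "\<nexists>c. adj v c \<and> c \<noteq> a \<and> c \<noteq> b"
  then have "{u. adj v u} = {a, b}"
    by auto
  then have "degree T v = 2"
    using degree_eq_card_neighbours[OF T_facts(1), of v] a(3) by simp
  then show False
    using hist adj_verts[OF a(1)] T_facts(4) by (simp add: HIST_def)
qed

text \<open>Having \<open>b\<close> as well would give degree 2.\<close>

lemma only_neighbour: "adj v a \<Longrightarrow> (\<And>u. adj v u \<Longrightarrow> u = a \<or> u = b) \<Longrightarrow> adj v u \<Longrightarrow> u = a"
  using third_neighbour[of v a b] by blast

text \<open>Degree 2 is forbidden, so three candidates leave just two possibilities; most case
  distinctions below are of this form.\<close>

lemma one_or_three: "adj v a \<Longrightarrow> (\<And>u. adj v u \<Longrightarrow> u = a \<or> u = b \<or> u = c) \<Longrightarrow>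
    (\<forall>u. adj v u \<longrightarrow> u = a) \<or> (adj v b \<and> adj v c)"
  using third_neighbour[of v a b] third_neighbour[of v a c] by blast

text \<open>The form in which connectedness of the tree is contradicted: \<open>S\<close> is a
  trapped part and \<open>y\<close> a vertex outside it.\<close>

lemma closed_set:
  assumes "x \<in> S" "x \<in> verts (strip m)" "y \<in> verts (strip m)" "y \<notin> S"
    and "\<And>u v. u \<in> S \<Longrightarrow> adj u v \<Longrightarrow> v \<in> S"
  shows False
  using connected_graph_closed_set[OF T_facts(2), of x S y] assms T_facts(4) by auto

lemma adj_graph: "adj x y \<Longrightarrow> {x, y} = {Mid 0, Mid 1} \<or> {x, y} \<in> edges (strip m)"
  using T_facts(5) edges_chorded_strip[of x y m] by blast

lemma adj_Hub: "adj (Hub i) u \<Longrightarrow> (i < m \<and> (u = Hub (Suc i) \<or> u = Mid i)) \<or>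
    (0 < i \<and> (u = Hub (i - 1) \<or> u = Mid (i - 1))) \<or> (i = 0 \<and> u = Rim 0) \<or> (i = m \<and> u = Rim (Suc m))"
  using adj_graph[of "Hub i" u] adj_verts[of "Hub i" u] adj_neq[of "Hub i" u]
  by (auto simp: doubleton_eq_iff elim!: verts_strip_cases[of u])

lemma adj_Mid: "adj (Mid i) u \<Longrightarrow> u = Hub i \<or> u = Hub (Suc i) \<or> u = Rim (Suc i) \<or>
    (i = 0 \<and> u = Mid 1) \<or> (i = 1 \<and> u = Mid 0)"
  using adj_graph[of "Mid i" u] adj_verts[of "Mid i" u]
  by (auto simp: doubleton_eq_iff elim!: verts_strip_cases[of u])

lemma adj_Rim: "adj (Rim i) u \<Longrightarrow> (i \<le> m \<and> u = Rim (Suc i)) \<or> (0 < i \<and> u = Rim (i - 1)) \<or>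
    (0 < i \<and> i \<le> m \<and> u = Mid (i - 1)) \<or> (i = 0 \<and> (u = Rim (Suc m) \<or> u = Hub 0)) \<or>
    (i = Suc m \<and> (u = Rim 0 \<or> u = Hub m))"
  using adj_graph[of "Rim i" u] adj_verts[of "Rim i" u]
  by (auto simp: doubleton_eq_iff elim!: verts_strip_cases[of u])

text \<open>A property of the tree and not of the graph: it fails only for \<open>Mid 0\<close> and
  \<open>Mid 1\<close>, and only when the tree uses the chord.\<close>

definition cubic :: "nat \<Rightarrow> bool" where
  "cubic i \<longleftrightarrow> (\<forall>u. adj (Mid i) u \<longrightarrow> u = Hub i \<or> u = Hub (Suc i) \<or> u = Rim (Suc i))"

text \<open>
  If both edges of the triangle \<^term>\<open>Hub i\<close>, \<^term>\<open>Hub (Suc i)\<close>, \<^term>\<open>Mid i\<close> at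
  \<^term>\<open>Hub i\<close> are used, then \<^term>\<open>Mid i\<close> is a leaf, and \<^term>\<open>Hub (Suc i)\<close> is a leaf or
  uses both edges of the next triangle: the tree never leaves the row of triangles.
\<close>

lemma trapped_right:
  assumes "i < m" "adj (Hub i) (Hub (Suc i))" "adj (Hub i) (Mid i)" "\<And>k. i \<le> k \<Longrightarrow> cubic k"
  shows "\<exists>X. X \<subseteq> {Hub k |k. i < k} \<union> {Mid k |k. i \<le> k} \<and> Mid i \<in> X \<and> Hub (Suc i) \<in> X \<and>
    (\<forall>x\<in>X. \<forall>u. adj x u \<longrightarrow> u \<in> X \<or> u = Hub i)"
  using assms
proof (induction "m - i" arbitrary: i rule: less_induct)
  case less
  have no: "\<not> adj (Mid i) (Hub (Suc i))"
    using no_triangle[of "Hub i" "Hub (Suc i)" "Mid i"] less.prems adj_sym by blast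
  have mid: "u = Hub i" if "adj (Mid i) u" for u
    using only_neighbour[of "Mid i" "Hub i" "Rim (Suc i)" u] that no less.prems(3) less.prems(4)[of i] adj_sym
    unfolding cubic_def by blast
  have nb: "u = Hub i \<or> (Suc i < m \<and> (u = Hub (Suc (Suc i)) \<or> u = Mid (Suc i))) \<or> (Suc i = m \<and> u = Rim (Suc m))"
    if "adj (Hub (Suc i)) u" for u
    using adj_Hub[OF that] no adj_sym that by auto
  show ?case
  proof (cases "Suc i < m \<and> adj (Hub (Suc i)) (Hub (Suc (Suc i))) \<and> adj (Hub (Suc i)) (Mid (Suc i))")
    case True
    obtain X where X: "X \<subseteq> {Hub k |k. Suc i < k} \<union> {Mid k |k. Suc i \<le> k}"
      "Mid (Suc i) \<in> X" "Hub (Suc (Suc i)) \<in> X"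
      "\<And>x u. x \<in> X \<Longrightarrow> adj x u \<Longrightarrow> u \<in> X \<or> u = Hub (Suc i)"
    proof -
      have "\<And>k. Suc i \<le> k \<Longrightarrow> cubic k"
        using less.prems(4) by simp
      with less.hyps[of "Suc i"] True show thesis
        using that by (auto simp: diff_less_mono2)
    qed
    have "X \<union> {Hub (Suc i), Mid i} \<subseteq> {Hub k |k. i < k} \<union> {Mid k |k. i \<le> k}"
      using X(1) by force
    moreover have "u \<in> X \<union> {Hub (Suc i), Mid i} \<or> u = Hub i" if "x \<in> X \<union> {Hub (Suc i), Mid i}" "adj x u" for x u
      using that X mid nb True by blast
    ultimately show ?thesis
      by blast
  next
    case False
    \<comment> \<open>Now \<open>Hub (Suc i)\<close> is a leaf. At the last hub the only other
      candidate is \<open>Rim (Suc m)\<close>; elsewhere there are three candidates, not all of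
      which are used.\<close>
    have "u = Hub i" if u: "adj (Hub (Suc i)) u" for u
      using one_or_three[of "Hub (Suc i)" "Hub i" "Hub (Suc (Suc i))" "Mid (Suc i)"]
        only_neighbour[of "Hub (Suc i)" "Hub i" "Rim (Suc m)" u] nb False u adj_sym[OF less.prems(2)]
        by (cases "Suc i = m") blast+
    then show ?thesis
      using mid by (intro exI[of _ "{Hub (Suc i), Mid i}"]) auto
  qed
qed

text \<open>The mirror image of \<open>trapped_right\<close>, but stopped at \<open>Hub f\<close>,
  as mids below \<open>f\<close> may use the chord. Either the chain of triangles ends with a leaf
  at a hub of index at least \<open>f\<close>, or it arrives at \<open>Hub f\<close> and both edges
  of the next triangle are in use. In the second case \<open>X\<close> may be empty, namely for
  \<open>f = i\<close>; that \<open>Mid f\<close> is trapped otherwise is recorded for the analysis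
  near the chord.\<close>

lemma trapped_left:
  assumes "f \<le> i" "i \<le> m" "0 < i" "adj (Hub i) (Hub (i - 1))" "adj (Hub i) (Mid (i - 1))"
    "\<And>k. f \<le> k \<Longrightarrow> k < i \<Longrightarrow> cubic k"
  shows "\<exists>X. X \<subseteq> {Hub k |k. f \<le> k \<and> k < i} \<union> {Mid k |k. f \<le> k \<and> k < i} \<and>
    (f < i \<longrightarrow> Hub (i - 1) \<in> X \<and> Mid (i - 1) \<in> X) \<and>
    ((\<forall>x\<in>X. \<forall>u. adj x u \<longrightarrow> u \<in> X \<or> u = Hub i) \<and> f < i \<or>
     0 < f \<and> adj (Hub f) (Hub (f - 1)) \<and> adj (Hub f) (Mid (f - 1)) \<and> (f < i \<longrightarrow> Mid f \<in> X) \<and>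
     (\<forall>x\<in>X. \<forall>u. adj x u \<longrightarrow> u \<in> X \<or> u = Hub i \<or> u = Hub (f - 1) \<or> u = Mid (f - 1)))"
  using assms
proof (induction i)
  case (Suc i)
  show ?case
  proof (cases "f = Suc i")
    case True
    then show ?thesis
      using Suc.prems by (intro exI[of _ "{}"]) auto
  next
    case False
    then have fi: "f \<le> i"
      using Suc.prems by simp
    have adj: "adj (Hub (Suc i)) (Hub i)" "adj (Hub (Suc i)) (Mid i)"
      using Suc.prems by auto
    have no: "\<not> adj (Mid i) (Hub i)"
      using no_triangle[of "Hub (Suc i)" "Hub i" "Mid i"] adj adj_sym by blast
    have mid: "u = Hub (Suc i)" if "adj (Mid i) u" for u
      using only_neighbour[of "Mid i" "Hub (Suc i)" "Rim (Suc i)" u] that no adj Suc.prems(6)[of i] fi adj_sym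
      unfolding cubic_def by blast
    have nb: "u = Hub (Suc i) \<or> (0 < i \<and> (u = Hub (i - 1) \<or> u = Mid (i - 1))) \<or> (i = 0 \<and> u = Rim 0)"
      if "adj (Hub i) u" for u
      using adj_Hub[OF that] no adj_sym that Suc.prems by auto
    show ?thesis
    proof (cases "0 < i \<and> adj (Hub i) (Hub (i - 1)) \<and> adj (Hub i) (Mid (i - 1))")
      case True
      have "\<exists>X. X \<subseteq> {Hub k |k. f \<le> k \<and> k < i} \<union> {Mid k |k. f \<le> k \<and> k < i} \<and>
        (f < i \<longrightarrow> Hub (i - 1) \<in> X \<and> Mid (i - 1) \<in> X) \<and>
        ((\<forall>x\<in>X. \<forall>u. adj x u \<longrightarrow> u \<in> X \<or> u = Hub i) \<and> f < i \<or>
         0 < f \<and> adj (Hub f) (Hub (f - 1)) \<and> adj (Hub f) (Mid (f - 1)) \<and> (f < i \<longrightarrow> Mid f \<in> X) \<and>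
         (\<forall>x\<in>X. \<forall>u. adj x u \<longrightarrow> u \<in> X \<or> u = Hub i \<or> u = Hub (f - 1) \<or> u = Mid (f - 1)))"
        using Suc.IH fi Suc.prems True by simp
      then obtain X where X: "X \<subseteq> {Hub k |k. f \<le> k \<and> k < i} \<union> {Mid k |k. f \<le> k \<and> k < i}"
        "f < i \<Longrightarrow> Hub (i - 1) \<in> X \<and> Mid (i - 1) \<in> X"
        and alt: "(\<forall>x\<in>X. \<forall>u. adj x u \<longrightarrow> u \<in> X \<or> u = Hub i) \<and> f < i \<or>
         0 < f \<and> adj (Hub f) (Hub (f - 1)) \<and> adj (Hub f) (Mid (f - 1)) \<and> (f < i \<longrightarrow> Mid f \<in> X) \<and>
         (\<forall>x\<in>X. \<forall>u. adj x u \<longrightarrow> u \<in> X \<or> u = Hub i \<or> u = Hub (f - 1) \<or> u = Mid (f - 1))"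
        by blast
      define Y where "Y = X \<union> {Hub i, Mid i}"
      have "Y \<subseteq> {Hub k |k. f \<le> k \<and> k < Suc i} \<union> {Mid k |k. f \<le> k \<and> k < Suc i}"
        using X(1) fi by (force simp: Y_def)
      moreover have "Hub (Suc i - 1) \<in> Y \<and> Mid (Suc i - 1) \<in> Y"
        by (simp add: Y_def)
      moreover have "(\<forall>x\<in>Y. \<forall>u. adj x u \<longrightarrow> u \<in> Y \<or> u = Hub (Suc i)) \<and> f < Suc i \<or>
         0 < f \<and> adj (Hub f) (Hub (f - 1)) \<and> adj (Hub f) (Mid (f - 1)) \<and> (f < Suc i \<longrightarrow> Mid f \<in> Y) \<and>
         (\<forall>x\<in>Y. \<forall>u. adj x u \<longrightarrow> u \<in> Y \<or> u = Hub (Suc i) \<or> u = Hub (f - 1) \<or> u = Mid (f - 1))"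
        using alt
      proof
        assume *: "(\<forall>x\<in>X. \<forall>u. adj x u \<longrightarrow> u \<in> X \<or> u = Hub i) \<and> f < i"
        have "u \<in> Y \<or> u = Hub (Suc i)" if "x \<in> Y" "adj x u" for x u
          using that * X(2) mid nb True unfolding Y_def by blast
        then show ?thesis
          using fi by auto
      next
        assume *: "0 < f \<and> adj (Hub f) (Hub (f - 1)) \<and> adj (Hub f) (Mid (f - 1)) \<and> (f < i \<longrightarrow> Mid f \<in> X) \<and>
         (\<forall>x\<in>X. \<forall>u. adj x u \<longrightarrow> u \<in> X \<or> u = Hub i \<or> u = Hub (f - 1) \<or> u = Mid (f - 1))"
        have "u \<in> Y \<or> u = Hub (Suc i) \<or> u = Hub (f - 1) \<or> u = Mid (f - 1)" if "x \<in> Y" "adj x u" for x u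
        proof (cases "f = i")
          case True
          then show ?thesis
            using that * mid nb unfolding Y_def by blast
        next
          case False
          then show ?thesis
            using that * X(2) fi mid nb unfolding Y_def by fastforce
        qed
        moreover have "Mid f \<in> Y"
          using * fi by (cases "f = i") (auto simp: Y_def)
        ultimately show ?thesis
          using * by blast
      qed
      ultimately show ?thesis
        by blast
    next
      case False
      have "u = Hub (Suc i)" if u: "adj (Hub i) u" for u
        using one_or_three[of "Hub i" "Hub (Suc i)" "Hub (i - 1)" "Mid (i - 1)"]
          only_neighbour[of "Hub i" "Hub (Suc i)" "Rim 0" u] nb False u adj_sym[OF adj(1)] by (cases "i = 0") blast+
      then show ?thesis
        using mid fi by (intro exI[of _ "{Hub i, Mid i}"]) auto
    qed
  qed
qed simp

section \<open>Exclusion of degree 4\<close>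

lemma cubic_ge_2: "2 \<le> k \<Longrightarrow> cubic k"
  using adj_Mid[of k] by (auto simp: cubic_def)

lemma cubic_no_chord: "\<not> adj (Mid 0) (Mid 1) \<Longrightarrow> cubic k"
  using adj_Mid[of k] adj_sym[of "Mid 1" "Mid 0"] by (auto simp: cubic_def)

text \<open>Index 2 is the first for which \<open>cubic\<close> holds whether or not the chord is
  used. The empty set serves when \<open>Hub 2\<close> does not enter the triangle, so that later
  closed sets can add \<open>X\<close> uniformly.\<close>

lemma trapped_right_of_2:
  "\<exists>X. X \<subseteq> {Hub k |k. 2 < k} \<union> {Mid k |k. 2 \<le> k} \<and>
    (adj (Hub 2) (Hub 3) \<and> adj (Hub 2) (Mid 2) \<longrightarrow> Hub 3 \<in> X \<and> Mid 2 \<in> X) \<and>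
    (\<forall>x\<in>X. \<forall>u. adj x u \<longrightarrow> u \<in> X \<or> u = Hub 2)"
proof (cases "adj (Hub 2) (Hub 3) \<and> adj (Hub 2) (Mid 2)")
  case True
  then have "adj (Hub 2) (Hub (Suc 2))" "adj (Hub 2) (Mid 2)"
    by simp_all
  from trapped_right[OF _ this cubic_ge_2] m show ?thesis
    by auto
next
  case False
  then show ?thesis
    by (intro exI[of _ "{}"]) auto
qed

text \<open>Triangles at \<open>Mid 0\<close> are excluded, which makes \<open>Hub 0\<close> and
  \<open>Hub 1\<close> leaves. If \<open>Mid 1\<close> branches, the square through
  \<open>Rim 1\<close> and \<open>Rim 2\<close> is excluded too and the part of \<open>Mid 0\<close>
  misses \<open>Rim 0\<close>; if \<open>Mid 1\<close> is a leaf, that part misses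
  \<open>Rim 3\<close>.\<close>

lemma not_all_adj_Mid_0:
  "\<not> (adj (Mid 0) (Hub 0) \<and> adj (Mid 0) (Hub 1) \<and> adj (Mid 0) (Rim 1) \<and> adj (Mid 0) (Mid 1))"
proof
  assume "adj (Mid 0) (Hub 0) \<and> adj (Mid 0) (Hub 1) \<and> adj (Mid 0) (Rim 1) \<and> adj (Mid 0) (Mid 1)"
  then have a: "adj (Mid 0) (Hub 0)" "adj (Mid 0) (Hub 1)" "adj (Mid 0) (Rim 1)" "adj (Mid 0) (Mid 1)"
    by blast+
  note a' = a[THEN adj_sym]
  have n1: "\<not> adj (Hub 0) (Hub 1)" and n2: "\<not> adj (Mid 1) (Hub 1)"
    using no_triangle[OF _ a'(2) a(1)] no_triangle[OF _ a'(2) a(4)] by blast+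
  note n' = n1 n2 n1[THEN contrapos_nn, OF adj_sym] n2[THEN contrapos_nn, OF adj_sym]
  have h0: "u = Mid 0" if "adj (Hub 0) u" for u
    using only_neighbour[OF a'(1), of "Rim 0" u] adj_Hub[of 0] that n' m by auto
  have h1: "u = Mid 0" if "adj (Hub 1) u" for u
    using only_neighbour[OF a'(2), of "Hub 2" u] adj_Hub[of 1] that n' m by (auto simp: numeral_2_eq_2)
  have h2: "u = Mid 1 \<or> u = Hub 3 \<or> u = Mid 2" if "adj (Hub 2) u" for u
    using adj_Hub[OF that] h1[of "Hub 2"] adj_sym[OF that] m by (auto simp: numeral_eq_Suc)
  have m1: "(\<forall>u. adj (Mid 1) u \<longrightarrow> u = Mid 0) \<or> adj (Mid 1) (Hub 2) \<and> adj (Mid 1) (Rim 2)"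
    using one_or_three[OF a'(4), of "Hub 2" "Rim 2"] adj_Mid[of 1] n' by (auto simp: numeral_2_eq_2)
  have r1: "u = Mid 0 \<or> u = Rim 0 \<or> u = Rim 2" if "adj (Rim 1) u" for u
    using adj_Rim[OF that] m by (auto simp: numeral_2_eq_2)
  have r2: "u = Mid 1 \<or> u = Rim 1 \<or> u = Rim 3" if "adj (Rim 2) u" for u
    using adj_Rim[OF that] m by (auto simp: numeral_eq_Suc)
  have m0: "u = Hub 0 \<or> u = Hub 1 \<or> u = Rim 1 \<or> u = Mid 1" if "adj (Mid 0) u" for u
    using adj_Mid[OF that] by auto
  obtain X where X: "X \<subseteq> {Hub k |k. 2 < k} \<union> {Mid k |k. 2 \<le> k}"
    "adj (Hub 2) (Hub 3) \<and> adj (Hub 2) (Mid 2) \<longrightarrow> Hub 3 \<in> X \<and> Mid 2 \<in> X"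
    "\<And>x u. x \<in> X \<Longrightarrow> adj x u \<Longrightarrow> u \<in> X \<or> u = Hub 2"
    using trapped_right_of_2 by blast
  show False
  proof (cases "adj (Mid 1) (Hub 2) \<and> adj (Mid 1) (Rim 2)")
    case True
    then have b: "adj (Mid 1) (Hub 2)" "adj (Mid 1) (Rim 2)" by blast+
    have n3: "\<not> adj (Rim 1) (Rim 2)"
      using no_square[OF a(3) _ adj_sym[OF b(2)] a'(4)] by auto
    have r1': "u = Mid 0" if "adj (Rim 1) u" for u
      using only_neighbour[OF a'(3), of "Rim 0" u] r1 n3 that by blast
    have r2': "u = Mid 1" if "adj (Rim 2) u" for u
      using only_neighbour[OF adj_sym[OF b(2)], of "Rim 3" u] r2 n3 adj_sym that by blast
    have h2': "u = Mid 1 \<or> u \<in> X" if "adj (Hub 2) u" for u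
      using one_or_three[OF adj_sym[OF b(1)], of "Hub 3" "Mid 2"] h2 X(2) that by blast
    have m1': "u = Mid 0 \<or> u = Hub 2 \<or> u = Rim 2" if "adj (Mid 1) u" for u
      using adj_Mid[OF that] that n' by (auto simp: numeral_2_eq_2)
    show False
    proof (rule closed_set[of "Mid 0" "{Mid 0, Mid 1, Hub 0, Hub 1, Hub 2, Rim 1, Rim 2} \<union> X" "Rim 0"])
      show "v \<in> {Mid 0, Mid 1, Hub 0, Hub 1, Hub 2, Rim 1, Rim 2} \<union> X"
        if "u \<in> {Mid 0, Mid 1, Hub 0, Hub 1, Hub 2, Rim 1, Rim 2} \<union> X" "adj u v" for u v
        using that m0 m1' h0 h1 h2' r1' r2' X(3) by blast
    qed (use m X(1) in auto)
  next
    case False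
    then have m1': "u = Mid 0" if "adj (Mid 1) u" for u
      using m1 that by blast
    show False
    proof (cases "adj (Rim 1) (Rim 0) \<and> adj (Rim 1) (Rim 2)")
      case True
      then have b: "adj (Rim 0) (Rim 1)" "adj (Rim 2) (Rim 1)"
        using adj_sym by blast+
      have r2': "u = Rim 1" if "adj (Rim 2) u" for u
        using only_neighbour[OF b(2), of "Rim 3" u] r2 m1'[of "Rim 2"] adj_sym[of "Rim 2" "Mid 1"] that by auto
      have r0': "u = Rim 1" if "adj (Rim 0) u" for u
        using only_neighbour[OF b(1), of "Rim (Suc m)" u] adj_Rim[of 0] h0[of "Rim 0"] adj_sym[of "Rim 0" "Hub 0"] that
        by auto
      show False
      proof (rule closed_set[of "Mid 0" "{Mid 0, Mid 1, Hub 0, Hub 1, Rim 1, Rim 2, Rim 0}" "Rim 3"])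
        show "v \<in> {Mid 0, Mid 1, Hub 0, Hub 1, Rim 1, Rim 2, Rim 0}"
          if "u \<in> {Mid 0, Mid 1, Hub 0, Hub 1, Rim 1, Rim 2, Rim 0}" "adj u v" for u v
          using that m0 m1' h0 h1 r1 r2' r0' by blast
      qed (use m in auto)
    next
      case False
      then have r1': "u = Mid 0" if "adj (Rim 1) u" for u
        using one_or_three[OF a'(3), of "Rim 0" "Rim 2"] r1 that by blast
      show False
      proof (rule closed_set[of "Mid 0" "{Mid 0, Mid 1, Hub 0, Hub 1, Rim 1}" "Rim 3"])
        show "v \<in> {Mid 0, Mid 1, Hub 0, Hub 1, Rim 1}"
          if "u \<in> {Mid 0, Mid 1, Hub 0, Hub 1, Rim 1}" "adj u v" for u v
          using that m0 m1' h0 h1 r1' by blast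
      qed (use m in auto)
    qed
  qed
qed

text \<open>\<open>Hub 1\<close> is a leaf, and what hangs on \<open>Hub 2\<close> is trapped to the
  right. The tree could escape only through \<open>Mid 0\<close> or \<open>Rim 2\<close>, and each
  of these has one or three neighbours.\<close>

lemma not_all_adj_Mid_1:
  "\<not> (adj (Mid 1) (Hub 1) \<and> adj (Mid 1) (Hub 2) \<and> adj (Mid 1) (Rim 2) \<and> adj (Mid 1) (Mid 0))"
proof
  assume "adj (Mid 1) (Hub 1) \<and> adj (Mid 1) (Hub 2) \<and> adj (Mid 1) (Rim 2) \<and> adj (Mid 1) (Mid 0)"
  then have a: "adj (Mid 1) (Hub 1)" "adj (Mid 1) (Hub 2)" "adj (Mid 1) (Rim 2)" "adj (Mid 1) (Mid 0)"
    by blast+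
  note a' = a[THEN adj_sym]
  have n1: "\<not> adj (Hub 2) (Hub 1)" and n2: "\<not> adj (Mid 0) (Hub 1)"
    using no_triangle[OF _ a'(1) a(2)] no_triangle[OF _ a'(1) a(4)] by blast+
  note n' = n1 n2 n1[THEN contrapos_nn, OF adj_sym] n2[THEN contrapos_nn, OF adj_sym]
  have h1: "u = Mid 1" if "adj (Hub 1) u" for u
    using only_neighbour[OF a'(1), of "Hub 0" u] adj_Hub[of 1] that n' m by (auto simp: numeral_2_eq_2)
  have h2: "u = Mid 1 \<or> u = Hub 3 \<or> u = Mid 2" if "adj (Hub 2) u" for u
    using adj_Hub[OF that] that n1 m by (auto simp: numeral_eq_Suc)
  have m0: "u = Mid 1 \<or> u = Hub 0 \<or> u = Rim 1" if "adj (Mid 0) u" for u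
    using adj_Mid[OF that] that n2 by auto
  have m1: "u = Hub 1 \<or> u = Hub 2 \<or> u = Rim 2 \<or> u = Mid 0" if "adj (Mid 1) u" for u
    using adj_Mid[OF that] by (auto simp: numeral_2_eq_2)
  have r1: "u = Mid 0 \<or> u = Rim 0 \<or> u = Rim 2" if "adj (Rim 1) u" for u
    using adj_Rim[OF that] m by (auto simp: numeral_2_eq_2)
  have r2: "u = Mid 1 \<or> u = Rim 1 \<or> u = Rim 3" if "adj (Rim 2) u" for u
    using adj_Rim[OF that] m by (auto simp: numeral_eq_Suc)
  have hh0: "u = Mid 0 \<or> u = Rim 0" if "adj (Hub 0) u" for u
    using adj_Hub[OF that] h1[of "Hub 0"] adj_sym[OF that] m by auto
  obtain X where X: "X \<subseteq> {Hub k |k. 2 < k} \<union> {Mid k |k. 2 \<le> k}"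
    "adj (Hub 2) (Hub 3) \<and> adj (Hub 2) (Mid 2) \<longrightarrow> Hub 3 \<in> X \<and> Mid 2 \<in> X"
    "\<And>x u. x \<in> X \<Longrightarrow> adj x u \<Longrightarrow> u \<in> X \<or> u = Hub 2"
    using trapped_right_of_2 by blast
  have h2': "u = Mid 1 \<or> u \<in> X" if "adj (Hub 2) u" for u
    using one_or_three[OF a'(2), of "Hub 3" "Mid 2"] h2 X(2) that by blast
  show False
  proof (cases "adj (Mid 0) (Hub 0) \<and> adj (Mid 0) (Rim 1)")
    case True
    then have b: "adj (Hub 0) (Mid 0)" "adj (Rim 1) (Mid 0)"
      using adj_sym by blast+
    have n3: "\<not> adj (Rim 1) (Rim 2)"
      using no_square[OF adj_sym[OF b(2)] _ a'(3) a(4)] by auto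
    have h0': "u = Mid 0" if "adj (Hub 0) u" for u
      using only_neighbour[OF b(1), of "Rim 0" u] hh0 that by blast
    have r1': "u = Mid 0" if "adj (Rim 1) u" for u
      using only_neighbour[OF b(2), of "Rim 0" u] r1 n3 that by blast
    have r2': "u = Mid 1" if "adj (Rim 2) u" for u
      using only_neighbour[OF a'(3), of "Rim 3" u] r2 n3 adj_sym that by blast
    show False
    proof (rule closed_set[of "Mid 0" "{Mid 0, Mid 1, Hub 0, Hub 1, Hub 2, Rim 1, Rim 2} \<union> X" "Rim 0"])
      show "v \<in> {Mid 0, Mid 1, Hub 0, Hub 1, Hub 2, Rim 1, Rim 2} \<union> X"
        if "u \<in> {Mid 0, Mid 1, Hub 0, Hub 1, Hub 2, Rim 1, Rim 2} \<union> X" "adj u v" for u v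
        using that m0 m1 h0' h1 h2' r1' r2' X(3) by blast
    qed (use m X(1) in auto)
  next
    case False
    then have m0': "u = Mid 1" if "adj (Mid 0) u" for u
      using one_or_three[OF a'(4), of "Hub 0" "Rim 1"] m0 that by blast
    show False
    proof (cases "adj (Rim 2) (Rim 1) \<and> adj (Rim 2) (Rim 3)")
      case True
      then have b: "adj (Rim 1) (Rim 2)"
        using adj_sym by blast
      have r1': "u = Rim 2" if "adj (Rim 1) u" for u
        using only_neighbour[OF b, of "Rim 0" u] r1 m0'[of "Rim 1"] adj_sym[of "Rim 1" "Mid 0"] that by auto
      \<comment> \<open>In this case the tree does escape along the rim through
        \<open>Rim 3\<close>, but \<open>Hub 0\<close> and \<open>Rim 0\<close> are then cut off
        with each other as their only neighbours.\<close>
      have h0': "u = Rim 0" if "adj (Hub 0) u" for u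
        using hh0[OF that] m0'[of "Hub 0"] adj_sym[OF that] by auto
      then have c: "adj (Rim 0) (Hub 0)"
        using neighbour_ex[of "Hub 0"] adj_sym by auto
      have r0': "u = Hub 0" if "adj (Rim 0) u" for u
        using only_neighbour[OF c, of "Rim (Suc m)" u] adj_Rim[of 0] r1'[of "Rim 0"] adj_sym[of "Rim 0" "Rim 1"] that
        by auto
      show False
        by (rule closed_set[of "Rim 0" "{Rim 0, Hub 0}" "Rim 1"]) (use h0' r0' in auto)
    next
      case False
      then have r2': "u = Mid 1" if "adj (Rim 2) u" for u
        using one_or_three[OF a'(3), of "Rim 1" "Rim 3"] r2 that by blast
      show False
      proof (rule closed_set[of "Mid 0" "{Mid 0, Mid 1, Hub 1, Hub 2, Rim 2} \<union> X" "Rim 0"])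
        show "v \<in> {Mid 0, Mid 1, Hub 1, Hub 2, Rim 2} \<union> X"
          if "u \<in> {Mid 0, Mid 1, Hub 1, Hub 2, Rim 2} \<union> X" "adj u v" for u v
          using that m0' m1 h1 h2' r2' X(3) by blast
      qed (use m X(1) in auto)
    qed
  qed
qed

text \<open>The right side is trapped in any case, and so is the left side unless the tree uses the
  chord and the chain runs through \<open>Hub 2\<close>. That last situation fixes the tree near the
  chord so far that it can be closed off by hand.\<close>

lemma not_all_adj_Hub:
  assumes i: "0 < i" "i < m"
  shows "\<not> (adj (Hub i) (Hub (i - 1)) \<and> adj (Hub i) (Hub (Suc i)) \<and>
    adj (Hub i) (Mid (i - 1)) \<and> adj (Hub i) (Mid i))"
proof
  assume "adj (Hub i) (Hub (i - 1)) \<and> adj (Hub i) (Hub (Suc i)) \<and> adj (Hub i) (Mid (i - 1)) \<and> adj (Hub i) (Mid i)"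
  then have a: "adj (Hub i) (Hub (i - 1))" "adj (Hub i) (Hub (Suc i))" "adj (Hub i) (Mid (i - 1))" "adj (Hub i) (Mid i)"
    by blast+
  \<comment> \<open>The bound from which on all mids are cubic. It does not exceed \<open>i\<close>:
    with the chord in use, \<open>i = 1\<close> would give the triangle \<open>Hub 1\<close>,
    \<open>Mid 0\<close>, \<open>Mid 1\<close>.\<close>
  define f :: nat where "f = (if adj (Mid 0) (Mid 1) then 2 else 0)"
  have f: "f \<le> i"
  proof (rule ccontr)
    assume "\<not> f \<le> i"
    then have "i = 1" "adj (Mid 0) (Mid 1)"
      using i by (auto simp: f_def split: if_splits)
    then show False
      using no_triangle[of "Hub 1" "Mid 0" "Mid 1"] a adj_sym by simp
  qed
  have cub: "cubic k" if "f \<le> k" for k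
    using that cubic_ge_2 cubic_no_chord by (auto simp: f_def split: if_splits)
  obtain R where R: "R \<subseteq> {Hub k |k. i < k} \<union> {Mid k |k. i \<le> k}" "Mid i \<in> R" "Hub (Suc i) \<in> R"
    "\<And>x u. x \<in> R \<Longrightarrow> adj x u \<Longrightarrow> u \<in> R \<or> u = Hub i"
    using trapped_right[OF i(2) a(2) a(4)] cub f by (metis (no_types, lifting) le_trans)
  obtain L where L: "L \<subseteq> {Hub k |k. f \<le> k \<and> k < i} \<union> {Mid k |k. f \<le> k \<and> k < i}"
    "f < i \<Longrightarrow> Hub (i - 1) \<in> L \<and> Mid (i - 1) \<in> L"
    and alt: "(\<forall>x\<in>L. \<forall>u. adj x u \<longrightarrow> u \<in> L \<or> u = Hub i) \<and> f < i \<or>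
     0 < f \<and> adj (Hub f) (Hub (f - 1)) \<and> adj (Hub f) (Mid (f - 1)) \<and> (f < i \<longrightarrow> Mid f \<in> L) \<and>
     (\<forall>x\<in>L. \<forall>u. adj x u \<longrightarrow> u \<in> L \<or> u = Hub i \<or> u = Hub (f - 1) \<or> u = Mid (f - 1))"
    using trapped_left[OF f less_imp_le[OF i(2)] i(1) a(1) a(3) cub] by blast
  have hub: "u = Hub (i - 1) \<or> u = Mid (i - 1) \<or> u \<in> R" if "adj (Hub i) u" for u
    using adj_Hub[OF that] i R(2,3) by auto
  define X where "X = L \<union> R \<union> {Hub i}"
  have Xsub: "X \<subseteq> {Hub k |k. f \<le> k} \<union> {Mid k |k. f \<le> k}"
    using L(1) R(1) f by (force simp: X_def)
  show False
    using alt
  proof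
    assume *: "(\<forall>x\<in>L. \<forall>u. adj x u \<longrightarrow> u \<in> L \<or> u = Hub i) \<and> f < i"
    show False
    proof (rule closed_set[of "Hub i" X "Rim 0"])
      show "v \<in> X" if "u \<in> X" "adj u v" for u v
        using that * L(2) R(4) hub unfolding X_def by blast
    qed (use i Xsub in \<open>auto simp: X_def\<close>)
  next
    assume *: "0 < f \<and> adj (Hub f) (Hub (f - 1)) \<and> adj (Hub f) (Mid (f - 1)) \<and> (f < i \<longrightarrow> Mid f \<in> L) \<and>
     (\<forall>x\<in>L. \<forall>u. adj x u \<longrightarrow> u \<in> L \<or> u = Hub i \<or> u = Hub (f - 1) \<or> u = Mid (f - 1))"
    \<comment> \<open>The chain has reached \<open>Hub 2\<close> and continues to
      \<open>Hub 1\<close> and \<open>Mid 1\<close>, while the chord joins \<open>Mid 1\<close> to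
      \<open>Mid 0\<close>.\<close>
    then have f2: "f = 2" and chord: "adj (Mid 0) (Mid 1)"
      by (auto simp: f_def split: if_splits)
    have b: "adj (Hub 1) (Hub 2)" "adj (Mid 1) (Hub 2)"
      using * f2 adj_sym by (auto simp: numeral_2_eq_2)
    have Xcl: "v \<in> X \<or> v = Hub 1 \<or> v = Mid 1" if "u \<in> X" "adj u v" for u v
    proof (cases "u = Hub i \<and> f = i")
      case True
      then show ?thesis
        using hub that f2 unfolding X_def by fastforce
    next
      case False
      then have "u = Hub i \<Longrightarrow> f < i"
        using f by simp
      then show ?thesis
        using that * L(2) R(4) hub f2 unfolding X_def by fastforce
    qed
    have "Mid 2 \<in> X" "Hub 2 \<in> X"
    proof -
      show "Mid 2 \<in> X"
        using * f f2 R(2) by (cases "i = 2") (auto simp: X_def)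
      \<comment> \<open>\<open>Hub 2\<close> is the only vertex of \<open>X\<close> that can be
        joined to \<open>Hub 1\<close> or \<open>Mid 1\<close>; without it \<open>X\<close> would be
        closed.\<close>
      show "Hub 2 \<in> X"
      proof (rule ccontr)
        assume no: "Hub 2 \<notin> X"
        show False
        proof (rule closed_set[of "Hub i" X "Rim 0"])
          show "v \<in> X" if "u \<in> X" "adj u v" for u v
          proof -
            have "u \<noteq> Hub 2"
              using no that by blast
            then show ?thesis
              using Xcl[OF that] Xsub that adj_Hub[of 1 u] adj_Mid[of 1 u] adj_sym[OF that(2)] f2 by (auto simp: numeral_2_eq_2)
          qed
        qed (use i Xsub in \<open>auto simp: X_def\<close>)
      qed
    qed
    have n1: "\<not> adj (Hub 1) (Mid 1)"
      using no_triangle[OF _ b(2) adj_sym[OF b(1)]] by blast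
    have n2: "\<not> adj (Hub 1) (Mid 0)"
      using no_square[OF _ chord b(2) adj_sym[OF b(1)]] by auto
    note n' = n1 n2 n1[THEN contrapos_nn, OF adj_sym] n2[THEN contrapos_nn, OF adj_sym]
    have h1: "u = Hub 2" if "adj (Hub 1) u" for u
      using only_neighbour[OF b(1), of "Hub 0" u] adj_Hub[of 1] that n' m by (auto simp: numeral_2_eq_2)
    have m1: "u = Hub 2 \<or> u = Mid 0 \<or> u = Rim 2" if "adj (Mid 1) u" for u
      using adj_Mid[OF that] that n' by (auto simp: numeral_2_eq_2)
    \<comment> \<open>\<open>Mid 1\<close> already has the neighbours \<open>Hub 2\<close> and
      \<open>Mid 0\<close>, so it needs a third, and only \<open>Rim 2\<close> is left.\<close>
    have m1r2: "adj (Rim 2) (Mid 1)"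
      using third_neighbour[OF b(2) adj_sym[OF chord]] m1 adj_sym by auto
    have m0: "u = Mid 1 \<or> u = Hub 0 \<or> u = Rim 1" if "adj (Mid 0) u" for u
      using adj_Mid[OF that] that n' by auto
    have r1: "u = Mid 0 \<or> u = Rim 0 \<or> u = Rim 2" if "adj (Rim 1) u" for u
      using adj_Rim[OF that] m by (auto simp: numeral_2_eq_2)
    have r2: "u = Mid 1 \<or> u = Rim 1 \<or> u = Rim 3" if "adj (Rim 2) u" for u
      using adj_Rim[OF that] m by (auto simp: numeral_eq_Suc)
    \<comment> \<open>Since \<open>Mid 2\<close> is trapped, \<open>Rim 3\<close> has only two
      candidates. If it is joined to \<open>Rim 2\<close> it is a leaf there, so the tree cannot
      escape along the rim in this direction.\<close>
    have "\<not> adj (Mid 2) (Rim 3)"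
      using Xcl[OF \<open>Mid 2 \<in> X\<close>, of "Rim 3"] Xsub by auto
    then have r3: "u = Rim 2 \<or> u = Rim 4" if "adj (Rim 3) u" for u
      using adj_Rim[OF that] adj_sym[OF that] m by (auto simp: numeral_eq_Suc)
    show False
    proof (cases "adj (Rim 3) (Rim 2)")
      case True
      have r3': "u = Rim 2" if "adj (Rim 3) u" for u
        using only_neighbour[OF True r3 that] .
      have r21: "adj (Rim 1) (Rim 2)"
        using third_neighbour[OF m1r2 adj_sym[OF True]] r2 adj_sym by auto
      \<comment> \<open>Otherwise \<open>Mid 0\<close>, \<open>Rim 1\<close>, \<open>Rim 2\<close>,
        \<open>Mid 1\<close> would be a 4-cycle.\<close>
      have n3: "\<not> adj (Mid 0) (Rim 1)"
        using no_square[OF _ r21 m1r2 adj_sym[OF chord]] by auto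
      have r1': "u = Rim 2" if "adj (Rim 1) u" for u
        using only_neighbour[OF r21, of "Rim 0" u] r1 n3 adj_sym[of "Rim 1" "Mid 0"] that by auto
      have m0': "u = Mid 1" if "adj (Mid 0) u" for u
        using only_neighbour[OF chord, of "Hub 0" u] m0 n3 that by blast
      show False
      proof (rule closed_set[of "Mid 0" "X \<union> {Hub 1, Mid 1, Mid 0, Rim 1, Rim 2, Rim 3}" "Rim 0"])
        show "v \<in> X \<union> {Hub 1, Mid 1, Mid 0, Rim 1, Rim 2, Rim 3}"
          if "u \<in> X \<union> {Hub 1, Mid 1, Mid 0, Rim 1, Rim 2, Rim 3}" "adj u v" for u v
          using that h1 m0' m1 r1' r2 r3' Xcl \<open>Hub 2 \<in> X\<close> by blast
      qed (use m Xsub in auto)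
    next
      case False
      then have r2': "u = Mid 1" if "adj (Rim 2) u" for u
        using only_neighbour[OF m1r2, of "Rim 1" u] r2 adj_sym that by blast
      show False
      proof (cases "adj (Mid 0) (Hub 0) \<and> adj (Mid 0) (Rim 1)")
        case True
        then have c: "adj (Hub 0) (Mid 0)" "adj (Rim 1) (Mid 0)"
          using adj_sym by blast+
        have h0: "u = Mid 0" if "adj (Hub 0) u" for u
          using only_neighbour[OF c(1), of "Rim 0" u] adj_Hub[of 0] h1[of "Hub 0"] adj_sym[of "Hub 0" "Hub 1"] that m
          by auto
        have r1': "u = Mid 0" if "adj (Rim 1) u" for u
          using only_neighbour[OF c(2), of "Rim 0" u] r1 r2'[of "Rim 1"] adj_sym[of "Rim 1" "Rim 2"] that by auto
        show False
        proof (rule closed_set[of "Mid 0" "X \<union> {Hub 1, Mid 1, Mid 0, Hub 0, Rim 1, Rim 2}" "Rim 0"])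
          show "v \<in> X \<union> {Hub 1, Mid 1, Mid 0, Hub 0, Rim 1, Rim 2}"
            if "u \<in> X \<union> {Hub 1, Mid 1, Mid 0, Hub 0, Rim 1, Rim 2}" "adj u v" for u v
            using that h0 h1 m0 m1 r1' r2' Xcl \<open>Hub 2 \<in> X\<close> by blast
        qed (use m Xsub in auto)
      next
        case False
        then have m0': "u = Mid 1" if "adj (Mid 0) u" for u
          using one_or_three[OF chord, of "Hub 0" "Rim 1"] m0 that by blast
        show False
        proof (rule closed_set[of "Mid 0" "X \<union> {Hub 1, Mid 1, Mid 0, Rim 2}" "Rim 0"])
          show "v \<in> X \<union> {Hub 1, Mid 1, Mid 0, Rim 2}"
            if "u \<in> X \<union> {Hub 1, Mid 1, Mid 0, Rim 2}" "adj u v" for u v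
            using that h1 m0' m1 r2' Xcl \<open>Hub 2 \<in> X\<close> by blast
        qed (use m Xsub in auto)
      qed
    qed
  qed
qed

text \<open>The degree is positive by connectedness and different from 2; \<open>w\<close> lowers
  the bound 4 to 3 when there are four candidates. This leaves 1 and 3.\<close>

lemma odd_degree:
  assumes v: "v \<in> verts (strip m)" and sub: "\<And>u. adj v u \<Longrightarrow> u \<in> S" and S: "finite S" "card S \<le> 4"
    and w: "w \<in> S \<Longrightarrow> card S = 4 \<Longrightarrow> \<not> adj v w" "w \<in> S"
  shows "odd (degree T v)"
proof -
  define N where "N = {u. adj v u}"
  have deg: "degree T v = card N"
    using degree_eq_card_neighbours[OF T_facts(1)] by (simp add: N_def)
  have NS: "N \<subseteq> S"
    using sub by (auto simp: N_def)
  then have "finite N"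
    using S(1) finite_subset by blast
  moreover have "N \<noteq> {}"
    using neighbour_ex[OF v] by (auto simp: N_def)
  ultimately have "card N \<noteq> 0"
    by simp
  moreover have "card N \<noteq> 2"
    using hist v T_facts(4) deg by (auto simp: HIST_def)
  moreover have "card N \<le> 3"
  proof (cases "card S = 4")
    case True
    then have "N \<subset> S"
      using NS w by (auto simp: N_def)
    then show ?thesis
      using psubset_card_mono[OF S(1), of N] True by simp
  next
    case False
    then show ?thesis
      using card_mono[OF S(1) NS] S(2) by simp
  qed
  ultimately have "card N = 1 \<or> card N = 3"
    by auto
  then show ?thesis
    using deg by auto
qed

text \<open>Only inner hubs, \<open>Mid 0\<close> and \<open>Mid 1\<close> have four candidates, and
  the three exclusions supply the missing neighbour \<open>w\<close>. Then all degrees are odd,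
  against the odd order 3m + 3.\<close>

lemma contradiction: False
proof -
  have "odd (degree T v)" if v: "v \<in> verts (strip m)" for v
    using v
  proof (cases rule: verts_strip_cases)
    case (Hub i)
    consider "i = 0" | "i = m" | "0 < i" "i < m"
      using Hub by linarith
    then show ?thesis
    proof cases
      case 1
      show ?thesis
      proof (rule odd_degree[OF v, of "{Hub 1, Mid 0, Rim 0}" "Rim 0"])
        show "u \<in> {Hub 1, Mid 0, Rim 0}" if "adj v u" for u
          using adj_Hub[of 0 u] that Hub 1 m by (auto simp: numeral_2_eq_2)
      qed (use Hub 1 m in auto)
    next
      case 2
      show ?thesis
      proof (rule odd_degree[OF v, of "{Hub (m - 1), Mid (m - 1), Rim (Suc m)}" "Rim (Suc m)"])
        show "u \<in> {Hub (m - 1), Mid (m - 1), Rim (Suc m)}" if "adj v u" for u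
          using adj_Hub[of m u] that Hub 2 m by (auto simp: numeral_2_eq_2)
      qed (use Hub 2 m in auto)
    next
      case 3
      obtain w where w: "w \<in> {Hub (i - 1), Hub (Suc i), Mid (i - 1), Mid i}" "\<not> adj (Hub i) w"
        using not_all_adj_Hub[OF 3] by blast
      show ?thesis
      proof (rule odd_degree[OF v, of "{Hub (i - 1), Hub (Suc i), Mid (i - 1), Mid i}" w])
        show "u \<in> {Hub (i - 1), Hub (Suc i), Mid (i - 1), Mid i}" if "adj v u" for u
          using adj_Hub[of i u] that Hub 3 by auto
      qed (use w Hub 3 in auto)
    qed
  next
    case (Mid i)
    consider "i = 0" | "i = 1" | "2 \<le> i"
      by linarith
    then show ?thesis
    proof cases
      case 1
      obtain w where w: "w \<in> {Hub 0, Hub 1, Rim 1, Mid 1}" "\<not> adj (Mid 0) w"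
        using not_all_adj_Mid_0 by blast
      show ?thesis
      proof (rule odd_degree[OF v, of "{Hub 0, Hub 1, Rim 1, Mid 1}" w])
        show "u \<in> {Hub 0, Hub 1, Rim 1, Mid 1}" if "adj v u" for u
          using adj_Mid[of 0 u] that Mid 1 m by (auto simp: numeral_2_eq_2)
      qed (use w Mid 1 m in auto)
    next
      case 2
      obtain w where w: "w \<in> {Hub 1, Hub 2, Rim 2, Mid 0}" "\<not> adj (Mid 1) w"
        using not_all_adj_Mid_1 by blast
      show ?thesis
      proof (rule odd_degree[OF v, of "{Hub 1, Hub 2, Rim 2, Mid 0}" w])
        show "u \<in> {Hub 1, Hub 2, Rim 2, Mid 0}" if "adj v u" for u
          using adj_Mid[of 1 u] that Mid 2 m by (auto simp: numeral_2_eq_2)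
      qed (use w Mid 2 m in auto)
    next
      case 3
      show ?thesis
      proof (rule odd_degree[OF v, of "{Hub i, Hub (Suc i), Rim (Suc i)}" "Hub i"])
        show "u \<in> {Hub i, Hub (Suc i), Rim (Suc i)}" if "adj v u" for u
          using adj_Mid[of i u] that Mid 3 m by (auto simp: numeral_2_eq_2)
      qed (use Mid 3 m in auto)
    qed
  next
    case (Rim i)
    consider "i = 0" | "i = Suc m" | "0 < i" "i \<le> m"
      using Rim by linarith
    then show ?thesis
    proof cases
      case 1
      show ?thesis
      proof (rule odd_degree[OF v, of "{Hub 0, Rim 1, Rim (Suc m)}" "Hub 0"])
        show "u \<in> {Hub 0, Rim 1, Rim (Suc m)}" if "adj v u" for u
          using adj_Rim[of 0 u] that Rim 1 m by (auto simp: numeral_2_eq_2)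
      qed (use Rim 1 m in auto)
    next
      case 2
      show ?thesis
      proof (rule odd_degree[OF v, of "{Hub m, Rim m, Rim 0}" "Hub m"])
        show "u \<in> {Hub m, Rim m, Rim 0}" if "adj v u" for u
          using adj_Rim[of "Suc m" u] that Rim 2 m by (auto simp: numeral_2_eq_2)
      qed (use Rim 2 m in auto)
    next
      case 3
      show ?thesis
      proof (rule odd_degree[OF v, of "{Mid (i - 1), Rim (i - 1), Rim (Suc i)}" "Rim (Suc i)"])
        show "u \<in> {Mid (i - 1), Rim (i - 1), Rim (Suc i)}" if "adj v u" for u
          using adj_Rim[of i u] that Rim 3 m by (auto simp: numeral_2_eq_2)
      qed (use Rim 3 m in auto)
    qed
  qed
  then have "even (card (verts T))"
    using even_order_if_odd_degrees[OF T_facts(1)] T_facts(4) by simp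
  then show False
    using card_verts_strip[of m] T_facts(4) m(1) by simp
qed

end

lemma HIST_free_chorded_strip:
  assumes "even m" "m \<ge> 4"
  shows "HIST_free (chorded_strip m)"
  unfolding HIST_free_def
proof
  assume "\<exists>T. HIST T (chorded_strip m)"
  then obtain T where "HIST T (chorded_strip m)" ..
  then interpret chorded_strip_HIST m T
    using assms by unfold_locales
  show False
    by (rule contradiction)
qed

section \<open>Connectivity\<close>

definition link :: "'a graph \<Rightarrow> 'a \<Rightarrow> 'a \<Rightarrow> bool" where
  "link G x y \<longleftrightarrow> (x, y) \<in> {(x, y). {x, y} \<in> edges G}\<^sup>*"

lemma link_edge: "{x, y} \<in> edges G \<Longrightarrow> link G x y"
  by (auto simp: link_def)

lemma link_sym: "link G x y \<Longrightarrow> link G y x"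
  unfolding link_def by (rule reachable_sym)

lemma link_trans: "link G x y \<Longrightarrow> link G y z \<Longrightarrow> link G x z"
  unfolding link_def by (rule rtrancl_trans)

lemma connected_graphI:
  assumes "a \<in> verts G" "\<And>x. x \<in> verts G \<Longrightarrow> link G x a"
  shows "connected_graph G"
  unfolding connected_graph_def link_def[symmetric]
  using assms link_trans[OF assms(2) link_sym[OF assms(2)]] by blast

lemma link_path:
  assumes "i \<le> j" "\<And>k. i \<le> k \<Longrightarrow> k < j \<Longrightarrow> {f k, f (Suc k)} \<in> edges G"
  shows "link G (f i) (f j)"
  using assms
proof (induction j rule: dec_induct)
  case (step k)
  then have "link G (f i) (f k)" "link G (f k) (f (Suc k))"
    by (auto intro: link_edge)
  then show ?case
    by (rule link_trans)
qed (simp add: link_def)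

text \<open>The hub path and all mids are intact, and every remaining rim vertex is joined to one of
  them.\<close>

lemma connected_del_strip_Rims:
  assumes X: "X \<subseteq> Rim ` UNIV" and m: "0 < m"
  shows "connected_graph (del_verts (strip m) X)"
proof -
  let ?G = "del_verts (strip m) X"
  have ok: "Hub i \<notin> X" "Mid i \<notin> X" for i
    using X by auto
  have hub: "link ?G (Hub i) (Hub 0)" if "i \<le> m" for i
    using that ok by (intro link_sym[OF link_path]) auto
  have mid: "link ?G (Mid i) (Hub 0)" if "i < m" for i
    using link_trans[OF link_edge[of "Mid i" "Hub i" ?G] hub[of i]] that ok by auto
  show ?thesis
  proof (rule connected_graphI[of "Hub 0"])
    fix x assume x: "x \<in> verts ?G"
    then have "x \<in> verts (strip m)" by simp
    then show "link ?G x (Hub 0)"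
    proof (cases rule: verts_strip_cases)
      case (Rim i)
      consider "i = 0" | "i = Suc m" | j where "i = Suc j" "j < m"
        using Rim(2) by (metis Suc_le_mono le_neq_implies_less not0_implies_Suc)
      then show ?thesis
      proof cases
        case 1
        then show ?thesis
          using Rim x ok by (auto intro!: link_edge)
      next
        case 2
        then show ?thesis
          using link_trans[OF link_edge[of x "Hub m" ?G] hub[of m]] Rim x ok by auto
      next
        case 3
        then show ?thesis
          using link_trans[OF link_edge[of x "Mid j" ?G] mid[of j]] Rim x ok by auto
      qed
    qed (use hub mid in auto)
  qed (use ok in auto)
qed

text \<open>
  \<^term>\<open>Hub i\<close> has two routes to the rim, over \<^term>\<open>Mid (i - 1)\<close> to \<^term>\<open>Rim i\<close> and over
  \<^term>\<open>Mid i\<close> to \<^term>\<open>Rim (Suc i)\<close>; if both are blocked by the two deleted vertices, then one of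
  the routes of a neighbouring hub is open.
\<close>

lemma connected_del_strip_one_Rim:
  assumes X: "\<And>k l. Rim k \<in> X \<Longrightarrow> Rim l \<in> X \<Longrightarrow> k = l"
    and Y: "\<And>k x y. Rim k \<in> X \<Longrightarrow> x \<in> X \<Longrightarrow> y \<in> X \<Longrightarrow> x \<noteq> Rim k \<Longrightarrow> y \<noteq> Rim k \<Longrightarrow> x = y"
    and Z: "finite X" "card X \<le> 2" and m: "m \<ge> 2"
  shows "connected_graph (del_verts (strip m) X)"
proof -
  let ?G = "del_verts (strip m) X"
  have two: "x = y \<or> y = z \<or> x = z" if "x \<in> X" "y \<in> X" "z \<in> X" for x y z
  proof (rule ccontr)
    assume "\<not> ?thesis"
    then have "card {x, y, z} = 3"
      by auto
    moreover have "card {x, y, z} \<le> card X"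
      using that Z(1) by (intro card_mono) auto
    ultimately show False
      using Z(2) by simp
  qed
  have rim: "link ?G (Rim i) (Rim j)" if ij: "i \<le> j" "j \<le> Suc m" "Rim i \<notin> X" "Rim j \<notin> X" for i j
  proof (cases "\<exists>k. i \<le> k \<and> k \<le> j \<and> Rim k \<in> X")
    case False
    then show ?thesis
      using ij by (intro link_path[of i j Rim]) auto
  next
    case True
    then obtain k where k: "i \<le> k" "k \<le> j" "Rim k \<in> X"
      by blast
    have ok: "Rim l \<notin> X" if "l \<le> i \<or> j \<le> l" for l
    proof (rule notI)
      assume l: "Rim l \<in> X"
      then have "l = k"
        using X k(3) by blast
      then have "l = i \<or> l = j"
        using k that by auto
      then show False
        using ij l by auto
    qed
    \<comment> \<open>The only deleted rim vertex lies between \<open>i\<close> and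
      \<open>j\<close>, so the rim is followed the other way round, over its closing edge.\<close>
    have "link ?G (Rim 0) (Rim i)" "link ?G (Rim j) (Rim (Suc m))"
      using ok ij by (auto intro!: link_path[of _ _ Rim])
    moreover have "link ?G (Rim 0) (Rim (Suc m))"
      using ok[of 0] ok[of "Suc m"] ij by (intro link_edge) auto
    ultimately show ?thesis
      using link_sym link_trans by metis
  qed
  obtain a where a: "a \<le> Suc m" "Rim a \<notin> X"
    using X[of 0 1] by (metis One_nat_def Suc_le_mono le0 zero_neq_one)
  have rim': "link ?G (Rim i) (Rim a)" if "i \<le> Suc m" "Rim i \<notin> X" for i
    using rim[of i a] rim[of a i] that a link_sym by (cases "i \<le> a") auto
  have midr: "link ?G (Mid i) (Rim a)" if "i < m" "Mid i \<notin> X" "Rim (Suc i) \<notin> X" for i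
    using link_trans[OF link_edge[of "Mid i" "Rim (Suc i)" ?G] rim'[of "Suc i"]] that by auto
  \<comment> \<open>Open left and right routes of \<open>Hub i\<close>. At the ends of the strip,
    \<open>Hub 0\<close> and \<open>Hub m\<close> are joined directly to the rim, so no mid is
    involved there.\<close>
  define L where "L i \<longleftrightarrow> Rim i \<notin> X \<and> (i = 0 \<or> Mid (i - 1) \<notin> X)" for i
  define R where "R i \<longleftrightarrow> Rim (Suc i) \<notin> X \<and> (i = m \<or> Mid i \<notin> X)" for i
  have hubL: "link ?G (Hub i) (Rim a)" if "i \<le> m" "Hub i \<notin> X" "L i" for i
  proof (cases "i = 0")
    case True
    then show ?thesis
      using link_trans[OF link_edge[of "Hub i" "Rim i" ?G] rim'[of i]] that by (auto simp: L_def)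
  next
    case False
    then show ?thesis
      using link_trans[OF link_edge[of "Hub i" "Mid (i - 1)" ?G] midr[of "i - 1"]] that by (auto simp: L_def)
  qed
  have hubR: "link ?G (Hub i) (Rim a)" if "i \<le> m" "Hub i \<notin> X" "R i" for i
  proof (cases "i = m")
    case True
    then show ?thesis
      using link_trans[OF link_edge[of "Hub i" "Rim (Suc i)" ?G] rim'[of "Suc i"]] that by (auto simp: R_def)
  next
    case False
    then show ?thesis
      using link_trans[OF link_edge[of "Hub i" "Mid i" ?G] midr[of i]] that by (auto simp: R_def)
  qed
  have hub: "link ?G (Hub i) (Rim a)" if i: "i \<le> m" "Hub i \<notin> X" for i
  proof (cases "L i \<or> R i")
    case True
    then show ?thesis
      using hubL hubR i by blast
  next
    case False
    obtain x where x: "x \<in> X" "x = Rim i \<or> 0 < i \<and> x = Mid (i - 1)"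
      using False by (auto simp: L_def)
    obtain y where y: "y \<in> X" "y = Rim (Suc i) \<or> i < m \<and> y = Mid i"
      using False i by (auto simp: R_def)
    \<comment> \<open>The blockers \<open>x\<close> and \<open>y\<close> of the two routes are
      always different, so they exhaust \<open>X\<close>.\<close>
    have xy: "z = x \<or> z = y" if "z \<in> X" for z
      using two[OF x(1) y(1) that] x(2) y(2) by auto
    show ?thesis
    proof (cases "i < m \<and> (y = Mid i \<or> i = 0)")
      case True
      have "Hub (Suc i) \<notin> X" "R (Suc i)"
        using xy[of "Hub (Suc i)"] xy[of "Rim (Suc (Suc i))"] xy[of "Mid (Suc i)"] x(2) y(2) by (auto simp: R_def)
      moreover have "{Hub i, Hub (Suc i)} \<in> edges ?G"
        using calculation True i by auto
      ultimately show ?thesis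
        using link_trans[OF link_edge hubR[of "Suc i"]] True by simp
    next
      case False
      have x': "0 < i"
      proof (rule ccontr)
        assume "\<not> 0 < i"
        with False m show False by simp
      qed
      show ?thesis
      proof (cases "i < m")
        case True
        then have yR: "y = Rim (Suc i)"
          using False y by auto
        then have "x \<noteq> Rim i"
          using X[of i "Suc i"] x(1) y(1) by auto
        then have xM: "x = Mid (i - 1)"
          using x(2) by auto
        have "Hub (i - 1) \<notin> X" "L (i - 1)"
          using xy[of "Hub (i - 1)"] xy[of "Rim (i - 1)"] xy[of "Mid (i - 1 - 1)"] xM yR x' by (auto simp: L_def)
        moreover have "{Hub i, Hub (i - 1)} \<in> edges ?G"
          using calculation x' i by auto
        ultimately show ?thesis
          using link_trans[OF link_edge hubL[of "i - 1"]] i by simp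
      next
        case False
        then have im: "i = m" and yR: "y = Rim (Suc i)"
          using i y by auto
        then have "x \<noteq> Rim i"
          using X[of i "Suc i"] x(1) y(1) by auto
        then have xM: "x = Mid (i - 1)"
          using x(2) by auto
        have "Hub (i - 1) \<notin> X" "L (i - 1)"
          using xy[of "Hub (i - 1)"] xy[of "Rim (i - 1)"] xy[of "Mid (i - 1 - 1)"] xM yR x' by (auto simp: L_def)
        moreover have "{Hub i, Hub (i - 1)} \<in> edges ?G"
          using calculation x' i by auto
        ultimately show ?thesis
          using link_trans[OF link_edge hubL[of "i - 1"]] i by simp
      qed
    qed
  qed
  have mid: "link ?G (Mid i) (Rim a)" if i: "i < m" "Mid i \<notin> X" for i
  proof (cases "Rim (Suc i) \<in> X")
    case False
    then show ?thesis
      using midr i by blast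
  next
    case True
    \<comment> \<open>Besides \<open>Rim (Suc i)\<close> at most one vertex is deleted, so one of
      the two hubs next to \<open>Mid i\<close> survives.\<close>
    have "Hub i \<notin> X \<or> Hub (Suc i) \<notin> X"
      using Y[OF True, of "Hub i" "Hub (Suc i)"] by auto
    then show ?thesis
    proof
      assume h: "Hub i \<notin> X"
      then have "{Mid i, Hub i} \<in> edges ?G"
        using i by auto
      then show ?thesis
        using link_trans[OF link_edge hub[of i]] h i by simp
    next
      assume h: "Hub (Suc i) \<notin> X"
      then have "{Mid i, Hub (Suc i)} \<in> edges ?G"
        using i by auto
      then show ?thesis
        using link_trans[OF link_edge hub[of "Suc i"]] h i by simp
    qed
  qed
  show ?thesis
  proof (rule connected_graphI[of "Rim a"])
    fix x assume x: "x \<in> verts ?G"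
    then have "x \<in> verts (strip m)" by simp
    then show "link ?G x (Rim a)"
      by (cases rule: verts_strip_cases) (use x hub mid rim' in auto)
  qed (use a in auto)
qed

text \<open>Two deleted rim vertices exhaust the cut, and then the hubs hold the graph together;
  with at most one, the rest of the rim is a path to which everything is linked.\<close>

lemma three_connected_strip:
  assumes m: "m \<ge> 2"
  shows "three_connected (strip m)"
  unfolding three_connected_def
proof (intro conjI allI impI)
  show "3 < card (verts (strip m))"
    using card_verts_strip m by simp
next
  fix X assume X: "X \<subseteq> verts (strip m) \<and> card X < 3"
  then have fin: "finite X"
    using simple_graph_strip[of m] finite_subset by (auto simp: simple_graph_def)
  show "connected_graph (del_verts (strip m) X)"
  proof (cases "\<exists>k l. k \<noteq> l \<and> Rim k \<in> X \<and> Rim l \<in> X")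
    case True
    then obtain k l where kl: "k \<noteq> l" "Rim k \<in> X" "Rim l \<in> X"
      by blast
    then have "card {Rim k, Rim l} = 2" "{Rim k, Rim l} \<subseteq> X"
      by auto
    then have "X = {Rim k, Rim l}"
      using X fin card_subset_eq[of X "{Rim k, Rim l}"] card_mono[of X "{Rim k, Rim l}"] by auto
    then show ?thesis
      using m by (intro connected_del_strip_Rims) auto
  next
    case False
    show ?thesis
    proof (rule connected_del_strip_one_Rim)
      fix k x y assume a: "Rim k \<in> X" "x \<in> X" "y \<in> X" "x \<noteq> Rim k" "y \<noteq> Rim k"
      show "x = y"
      proof (rule ccontr)
        assume "x \<noteq> y"
        then have "card {Rim k, x, y} = 3"
          using a by auto
        moreover have "card {Rim k, x, y} \<le> card X"
          using a fin by (intro card_mono) auto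
        ultimately show False
          using X by simp
      qed
    qed (use False X fin m in auto)
  qed
qed

section \<open>A straight line drawing\<close>

lemma in_segment_coords:
  assumes "z \<in> closed_segment a b"
  shows "\<exists>u. 0 \<le> u \<and> u \<le> 1 \<and> Re z = (1 - u) * Re a + u * Re b \<and> Im z = (1 - u) * Im a + u * Im b"
proof -
  obtain u where "0 \<le> u" "u \<le> 1" "z = (1 - u) *\<^sub>R a + u *\<^sub>R b"
    using assms by (auto simp: in_segment)
  then show ?thesis
    by (intro exI[of _ u]) simp
qed

text \<open>The segment parameter is eliminated, so that for concrete end points the conclusion is a
  linear equation in the coordinates of \<open>z\<close>.\<close>

lemma in_segment_below:
  assumes z: "z \<in> closed_segment a b" and h: "Im a < Im b"
  shows "Im a \<le> Im z" "Im z \<le> Im b"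
    "(Im b - Im a) * (Re z - Re a) = (Im z - Im a) * (Re b - Re a)"
proof -
  obtain u where u: "0 \<le> u" "u \<le> 1" "Re z = (1 - u) * Re a + u * Re b" "Im z = (1 - u) * Im a + u * Im b"
    using in_segment_coords[OF z] by blast
  have *: "Im z - Im a = u * (Im b - Im a)" "Re z - Re a = u * (Re b - Re a)"
    using u(3,4) by (simp_all add: algebra_simps)
  then show "(Im b - Im a) * (Re z - Re a) = (Im z - Im a) * (Re b - Re a)"
    by simp
  have "0 \<le> u * (Im b - Im a)" "u * (Im b - Im a) \<le> 1 * (Im b - Im a)"
    using u(1,2) h by (intro mult_nonneg_nonneg mult_right_mono; simp)+
  then show "Im a \<le> Im z" "Im z \<le> Im b"
    using * by simp_all
qed

lemma in_segment_horizontal: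
  assumes z: "z \<in> closed_segment a b" and h: "Im a = Im b" "Re a < Re b"
  shows "Im z = Im a" "Re a \<le> Re z" "Re z \<le> Re b"
proof -
  obtain u where u: "0 \<le> u" "u \<le> 1" "Re z = (1 - u) * Re a + u * Re b" "Im z = (1 - u) * Im a + u * Im b"
    using in_segment_coords[OF z] by blast
  have *: "Im z = Im a" "Re z - Re a = u * (Re b - Re a)"
    using u(3,4) h(1) by (simp_all add: algebra_simps)
  have "0 \<le> u * (Re b - Re a)" "u * (Re b - Re a) \<le> 1 * (Re b - Re a)"
    using u(1,2) h(2) by (intro mult_nonneg_nonneg mult_right_mono; simp)+
  then show "Im z = Im a" "Re a \<le> Re z" "Re z \<le> Re b"
    using * by simp_all
qed

text \<open>Hubs lie at height 2, mids at height 1, and \<open>Rim (Suc i)\<close> lies straight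
  below \<open>Mid i\<close> at height 0. Only \<open>Rim 0\<close> and \<open>Rim (Suc m)\<close>
  are lowered to -1, so that the closing edge of the rim passes under the others. The chord runs
  horizontally below \<open>Hub 1\<close>.\<close>

definition pos :: "nat \<Rightarrow> nat \<Rightarrow> complex" where
  "pos m = vertex_case (\<lambda>i. Complex (2 * real i) 2) (\<lambda>i. Complex (2 * real i + 1) 1)
     (\<lambda>i. Complex (2 * real i - 1) (if i = 0 \<or> i = Suc m then -1 else 0))"

lemma pos_simps [simp]:
  "pos m (Hub i) = Complex (2 * real i) 2"
  "pos m (Mid i) = Complex (2 * real i + 1) 1"
  "pos m (Rim i) = Complex (2 * real i - 1) (if i = 0 \<or> i = Suc m then -1 else 0)"
  by (simp_all add: pos_def)

lemma inj_on_pos: "inj_on (pos m) (verts (strip m))"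
proof (rule inj_onI)
  fix x y assume x: "x \<in> verts (strip m)" and y: "y \<in> verts (strip m)" and eq: "pos m x = pos m y"
  from x show "x = y"
  proof (cases rule: verts_strip_cases)
    case (Hub i)
    from y show ?thesis
      by (cases rule: verts_strip_cases) (use Hub eq in \<open>simp_all split: if_splits\<close>)
  next
    case (Mid i)
    from y show ?thesis
      by (cases rule: verts_strip_cases) (use Mid eq in \<open>simp_all split: if_splits\<close>)
  next
    case (Rim i)
    from y show ?thesis
      by (cases rule: verts_strip_cases) (use Rim eq in \<open>simp_all split: if_splits\<close>)
  qed
qed

lemma chorded_edge_cases:
  assumes "e \<in> edges (chorded_strip m)" "0 < m"
  obtains
    (hub) i where "e = {Hub i, Hub (Suc i)}" "i < m"
  | (left) i where "e = {Mid i, Hub i}" "i < m"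
  | (right) i where "e = {Mid i, Hub (Suc i)}" "i < m"
  | (spoke) i where "e = {Mid i, Rim (Suc i)}" "i < m"
  | (rim) i where "e = {Rim i, Rim (Suc i)}" "0 < i" "i < m"
  | (rim_first) "e = {Rim 0, Rim (Suc 0)}"
  | (rim_last) "e = {Rim m, Rim (Suc m)}"
  | (base) "e = {Rim 0, Rim (Suc m)}"
  | (side_first) "e = {Hub 0, Rim 0}"
  | (side_last) "e = {Hub m, Rim (Suc m)}"
  | (chord) "e = {Mid 0, Mid (Suc 0)}"
proof -
  have "(\<exists>i. e = {Hub i, Hub (Suc i)} \<and> i < m) \<or> (\<exists>i. e = {Mid i, Hub i} \<and> i < m) \<or>
    (\<exists>i. e = {Mid i, Hub (Suc i)} \<and> i < m) \<or> (\<exists>i. e = {Mid i, Rim (Suc i)} \<and> i < m) \<or>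
    (\<exists>i. e = {Rim i, Rim (Suc i)} \<and> i \<le> m) \<or> e = {Rim 0, Rim (Suc m)} \<or> e = {Hub 0, Rim 0} \<or>
    e = {Hub m, Rim (Suc m)} \<or> e = {Mid 0, Mid (Suc 0)}"
    using assms(1) unfolding chorded_strip_def strip_def by simp blast
  then show thesis
  proof (elim disjE exE conjE)
    fix i assume i: "e = {Rim i, Rim (Suc i)}" "i \<le> m"
    consider "i = 0" | "i = m" | "0 < i" "i < m"
      using i by linarith
    then show thesis
      using i rim rim_first rim_last by cases simp_all
  qed (rule hub left right spoke base side_first side_last chord; assumption)+
qed

text \<open>
  \<^term>\<open>on_edge m i e x y\<close> says by linear constraints that the point $(x, y)$ lies on the drawn edge
  \<^term>\<open>e\<close>, and \<^term>\<open>inside_edge m i e x y\<close> that it also differs from both ends; \<^term>\<open>i\<close> is the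
  index of the edge within its family and arbitrary for the single edges.
\<close>

inductive on_edge :: "nat \<Rightarrow> nat \<Rightarrow> nat set \<Rightarrow> real \<Rightarrow> real \<Rightarrow> bool" for m where
  "\<lbrakk>i < m; y = 2; 2 * real i \<le> x; x \<le> 2 * real i + 2\<rbrakk> \<Longrightarrow> on_edge m i {Hub i, Hub (Suc i)} x y"
| "\<lbrakk>i < m; 1 \<le> y; y \<le> 2; x = 2 * real i + 2 - y\<rbrakk> \<Longrightarrow> on_edge m i {Mid i, Hub i} x y"
| "\<lbrakk>i < m; 1 \<le> y; y \<le> 2; x = 2 * real i + y\<rbrakk> \<Longrightarrow> on_edge m i {Mid i, Hub (Suc i)} x y"
| "\<lbrakk>i < m; 0 \<le> y; y \<le> 1; x = 2 * real i + 1\<rbrakk> \<Longrightarrow> on_edge m i {Mid i, Rim (Suc i)} x y"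
| "\<lbrakk>0 < i; i < m; y = 0; 2 * real i - 1 \<le> x; x \<le> 2 * real i + 1\<rbrakk> \<Longrightarrow> on_edge m i {Rim i, Rim (Suc i)} x y"
| "\<lbrakk>-1 \<le> y; y \<le> 0; x = 2 * y + 1\<rbrakk> \<Longrightarrow> on_edge m i {Rim 0, Rim (Suc 0)} x y"
| "\<lbrakk>-1 \<le> y; y \<le> 0; x = 2 * real m - 1 - 2 * y\<rbrakk> \<Longrightarrow> on_edge m i {Rim m, Rim (Suc m)} x y"
| "\<lbrakk>y = -1; -1 \<le> x; x \<le> 2 * real m + 1\<rbrakk> \<Longrightarrow> on_edge m i {Rim 0, Rim (Suc m)} x y"
| "\<lbrakk>-1 \<le> y; y \<le> 2; 3 * x = y - 2\<rbrakk> \<Longrightarrow> on_edge m i {Hub 0, Rim 0} x y"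
| "\<lbrakk>-1 \<le> y; y \<le> 2; 3 * x = 6 * real m + 2 - y\<rbrakk> \<Longrightarrow> on_edge m i {Hub m, Rim (Suc m)} x y"
| "\<lbrakk>y = 1; 1 \<le> x; x \<le> 3\<rbrakk> \<Longrightarrow> on_edge m i {Mid 0, Mid (Suc 0)} x y"

inductive inside_edge :: "nat \<Rightarrow> nat \<Rightarrow> nat set \<Rightarrow> real \<Rightarrow> real \<Rightarrow> bool" for m where
  "\<lbrakk>real i + 1 \<le> real m; y = 2; 2 * real i < x; x < 2 * real i + 2\<rbrakk> \<Longrightarrow> inside_edge m i {Hub i, Hub (Suc i)} x y"
| "\<lbrakk>real i + 1 \<le> real m; 1 < y; y < 2; x = 2 * real i + 2 - y\<rbrakk> \<Longrightarrow> inside_edge m i {Mid i, Hub i} x y"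
| "\<lbrakk>real i + 1 \<le> real m; 1 < y; y < 2; x = 2 * real i + y\<rbrakk> \<Longrightarrow> inside_edge m i {Mid i, Hub (Suc i)} x y"
| "\<lbrakk>real i + 1 \<le> real m; 0 < y; y < 1; x = 2 * real i + 1\<rbrakk> \<Longrightarrow> inside_edge m i {Mid i, Rim (Suc i)} x y"
| "\<lbrakk>1 \<le> real i; real i + 1 \<le> real m; y = 0; 2 * real i - 1 < x; x < 2 * real i + 1\<rbrakk> \<Longrightarrow> inside_edge m i {Rim i, Rim (Suc i)} x y"
| "\<lbrakk>-1 < y; y < 0; x = 2 * y + 1\<rbrakk> \<Longrightarrow> inside_edge m i {Rim 0, Rim (Suc 0)} x y"
| "\<lbrakk>-1 < y; y < 0; x = 2 * real m - 1 - 2 * y\<rbrakk> \<Longrightarrow> inside_edge m i {Rim m, Rim (Suc m)} x y"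
| "\<lbrakk>y = -1; -1 < x; x < 2 * real m + 1\<rbrakk> \<Longrightarrow> inside_edge m i {Rim 0, Rim (Suc m)} x y"
| "\<lbrakk>-1 < y; y < 2; 3 * x = y - 2\<rbrakk> \<Longrightarrow> inside_edge m i {Hub 0, Rim 0} x y"
| "\<lbrakk>-1 < y; y < 2; 3 * x = 6 * real m + 2 - y\<rbrakk> \<Longrightarrow> inside_edge m i {Hub m, Rim (Suc m)} x y"
| "\<lbrakk>y = 1; 1 < x; x < 3\<rbrakk> \<Longrightarrow> inside_edge m i {Mid 0, Mid (Suc 0)} x y"

lemma on_edge_if_in_segment:
  assumes e: "e \<in> edges (chorded_strip m)" and m: "m \<ge> 2"
    and z: "e = {a, b}" "z \<in> closed_segment (pos m a) (pos m b)"
  shows "\<exists>i. on_edge m i e (Re z) (Im z)"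
proof -
  have seg: "z \<in> closed_segment (pos m c) (pos m d)" if "e = {c, d}" for c d
    using that z closed_segment_commute by (auto simp: doubleton_eq_iff)
  have "0 < m" using m by simp
  with e show ?thesis
  proof (cases rule: chorded_edge_cases)
    case (hub i)
    then have "z \<in> closed_segment (Complex (2 * real i) 2) (Complex (2 * real i + 2) 2)"
      using seg[of "Hub i" "Hub (Suc i)"] m by (simp add: insert_commute algebra_simps)
    from in_segment_horizontal[OF this] have "Im z = 2" "2 * real i \<le> Re z" "Re z \<le> 2 * real i + 2"
      using m by (simp_all add: algebra_simps)
    with hub show ?thesis
      by (intro exI[of _ i]) (simp add: on_edge.intros(1))
  next
    case (left i)
    then have "z \<in> closed_segment (Complex (2 * real i + 1) 1) (Complex (2 * real i) 2)"
      using seg[of "Mid i" "Hub i"] m by (simp add: insert_commute algebra_simps)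
    from in_segment_below[OF this] have "1 \<le> Im z" "Im z \<le> 2" "Re z = 2 * real i + 2 - Im z"
      using m by (simp_all add: algebra_simps)
    with left show ?thesis
      by (intro exI[of _ i]) (simp add: on_edge.intros(2))
  next
    case (right i)
    then have "z \<in> closed_segment (Complex (2 * real i + 1) 1) (Complex (2 * real i + 2) 2)"
      using seg[of "Mid i" "Hub (Suc i)"] m by (simp add: insert_commute algebra_simps)
    from in_segment_below[OF this] have "1 \<le> Im z" "Im z \<le> 2" "Re z = 2 * real i + Im z"
      using m by (simp_all add: algebra_simps)
    with right show ?thesis
      by (intro exI[of _ i]) (simp add: on_edge.intros(3))
  next
    case (spoke i)
    then have "z \<in> closed_segment (Complex (2 * real i + 1) 0) (Complex (2 * real i + 1) 1)"
      using seg[of "Rim (Suc i)" "Mid i"] m by (simp add: insert_commute algebra_simps)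
    from in_segment_below[OF this] have "0 \<le> Im z" "Im z \<le> 1" "Re z = 2 * real i + 1"
      using m by (simp_all add: algebra_simps)
    with spoke show ?thesis
      by (intro exI[of _ i]) (simp add: on_edge.intros(4))
  next
    case (rim i)
    then have "z \<in> closed_segment (Complex (2 * real i - 1) 0) (Complex (2 * real i + 1) 0)"
      using seg[of "Rim i" "Rim (Suc i)"] m by (simp add: insert_commute algebra_simps)
    from in_segment_horizontal[OF this] have "Im z = 0" "2 * real i - 1 \<le> Re z" "Re z \<le> 2 * real i + 1"
      using m by (simp_all add: algebra_simps)
    with rim show ?thesis
      by (intro exI[of _ i]) (simp add: on_edge.intros(5))
  next
    case rim_first
    then have "z \<in> closed_segment (Complex (- 1) (- 1)) (Complex 1 0)"
      using seg[of "Rim 0" "Rim (Suc 0)"] m by (simp add: insert_commute algebra_simps)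
    from in_segment_below[OF this] have "- 1 \<le> Im z" "Im z \<le> 0" "Re z = 2 * Im z + 1"
      using m by (simp_all add: algebra_simps)
    with rim_first show ?thesis
      by (intro exI[of _ 0]) (simp add: on_edge.intros(6))
  next
    case rim_last
    then have "z \<in> closed_segment (Complex (2 * real m + 1) (- 1)) (Complex (2 * real m - 1) 0)"
      using seg[of "Rim (Suc m)" "Rim m"] m by (simp add: insert_commute algebra_simps)
    from in_segment_below[OF this] have "- 1 \<le> Im z" "Im z \<le> 0" "Re z = 2 * real m - 1 - 2 * Im z"
      using m by (simp_all add: algebra_simps)
    with rim_last show ?thesis
      by (intro exI[of _ 0]) (simp add: on_edge.intros(7))
  next
    case base
    then have "z \<in> closed_segment (Complex (- 1) (- 1)) (Complex (2 * real m + 1) (- 1))"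
      using seg[of "Rim 0" "Rim (Suc m)"] m by (simp add: insert_commute algebra_simps)
    from in_segment_horizontal[OF this] have "Im z = - 1" "- 1 \<le> Re z" "Re z \<le> 2 * real m + 1"
      using m by (simp_all add: algebra_simps)
    with base show ?thesis
      by (intro exI[of _ 0]) (simp add: on_edge.intros(8))
  next
    case side_first
    then have "z \<in> closed_segment (Complex (- 1) (- 1)) (Complex 0 2)"
      using seg[of "Rim 0" "Hub 0"] m by (simp add: insert_commute algebra_simps)
    from in_segment_below[OF this] have "- 1 \<le> Im z" "Im z \<le> 2" "3 * Re z = Im z - 2"
      using m by (simp_all add: algebra_simps)
    with side_first show ?thesis
      by (intro exI[of _ 0]) (simp add: on_edge.intros(9))
  next
    case side_last
    then have "z \<in> closed_segment (Complex (2 * real m + 1) (- 1)) (Complex (2 * real m) 2)"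
      using seg[of "Rim (Suc m)" "Hub m"] m by (simp add: insert_commute algebra_simps)
    from in_segment_below[OF this] have "- 1 \<le> Im z" "Im z \<le> 2" "3 * Re z = 6 * real m + 2 - Im z"
      using m by (simp_all add: algebra_simps)
    with side_last show ?thesis
      by (intro exI[of _ 0]) (simp add: on_edge.intros(10))
  next
    case chord
    then have "z \<in> closed_segment (Complex 1 1) (Complex 3 1)"
      using seg[of "Mid 0" "Mid (Suc 0)"] m by (simp add: insert_commute algebra_simps)
    from in_segment_horizontal[OF this] have "Im z = 1" "1 \<le> Re z" "Re z \<le> 3"
      using m by (simp_all add: algebra_simps)
    with chord show ?thesis
      by (intro exI[of _ 0]) (simp add: on_edge.intros(11))
  qed
qed

text \<open>Integrality of the indices, in a form that linear real arithmetic can use.\<close>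

lemma real_index_cases: "i = j \<or> real i + 1 \<le> real j \<or> real j + 1 \<le> real i"
proof (cases i j rule: linorder_cases)
  case less
  then have "real (Suc i) \<le> real j"
    by (simp only: of_nat_le_iff Suc_le_eq)
  then show ?thesis by simp
next
  case greater
  then have "real (Suc j) \<le> real i"
    by (simp only: of_nat_le_iff Suc_le_eq)
  then show ?thesis by simp
qed simp

lemma real_index_squeeze: "real i \<le> real k \<Longrightarrow> real k \<le> real i + 1 \<Longrightarrow> k = i \<or> k = Suc i"
  using real_index_cases[of i k] real_index_cases[of k "Suc i"] by auto

lemma vertex_on_edge:
  assumes e: "on_edge m i e (Re (pos m v)) (Im (pos m v))" and v: "v \<in> verts (strip m)" and m: "m \<ge> 2"
  shows "v \<in> e"
  using v
proof (cases rule: verts_strip_cases)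
  case (Hub k)
  from e show ?thesis
  proof cases
    case 1
    then have "k = i \<or> k = Suc i"
      using Hub by (intro real_index_squeeze) simp_all
    then show ?thesis
      using 1 Hub by auto
  qed (use Hub in simp_all)
next
  case (Mid k)
  have km: "real k + 1 \<le> real m"
    using real_index_cases[of k m] Mid by auto
  from e show ?thesis
  proof cases
    case 11
    then have "k = 0 \<or> k = Suc 0"
      using Mid by (intro real_index_squeeze) simp_all
    then show ?thesis
      using 11 Mid by auto
  qed (use Mid km in simp_all)
next
  case (Rim k)
  consider "k = 0" | "k = Suc m" | "0 < k" "k \<le> m"
    using Rim by linarith
  then show ?thesis
  proof cases
    case 1
    from e show ?thesis
      by cases (use Rim 1 m in simp_all)
  next
    case 2
    from e show ?thesis
      by cases (use Rim 2 m in simp_all)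
  next
    case 3
    then have k: "1 \<le> real k" "real k \<le> real m" "k \<noteq> Suc m"
      by simp_all
    from e show ?thesis
    proof cases
      case 5
      then have "k = i \<or> k = Suc i"
        using Rim 3 by (intro real_index_squeeze) simp_all
      then show ?thesis
        using 5 Rim by auto
    qed (use Rim 3 k in simp_all)
  qed
qed

lemma inside_edge_if_not_vertex:
  assumes e: "on_edge m i e x y" and m: "m \<ge> 2"
    and no: "\<And>v. v \<in> verts (strip m) \<Longrightarrow> pos m v \<noteq> Complex x y"
  shows "inside_edge m i e x y"
proof -
  have h: "y \<noteq> 2 \<or> x \<noteq> 2 * real k" if "k \<le> m" for k
    using no[of "Hub k"] that by auto
  have c: "y \<noteq> 1 \<or> x \<noteq> 2 * real k + 1" if "k < m" for k
    using no[of "Mid k"] that by auto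
  have r: "y \<noteq> 0 \<or> x \<noteq> 2 * real k - 1" if "0 < k" "k \<le> m" for k
    using no[of "Rim k"] that by auto
  have s: "y \<noteq> -1 \<or> x \<noteq> -1" "y \<noteq> -1 \<or> x \<noteq> 2 * real m + 1"
    using no[of "Rim 0"] no[of "Rim (Suc m)"] by auto
  show ?thesis
    using e
  proof cases
    case 1
    then show ?thesis
      using h[of i] h[of "Suc i"] by (auto intro!: inside_edge.intros(1))
  next
    case 2
    then show ?thesis
      using h[of i] c[of i] by (auto intro!: inside_edge.intros(2))
  next
    case 3
    then show ?thesis
      using h[of "Suc i"] c[of i] by (auto intro!: inside_edge.intros(3))
  next
    case 4
    then show ?thesis
      using c[of i] r[of "Suc i"] by (auto intro!: inside_edge.intros(4))
  next
    case 5
    then show ?thesis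
      using r[of i] r[of "Suc i"] by (auto intro!: inside_edge.intros(5))
  next
    case 6
    then show ?thesis
      using s r[of "Suc 0"] m by (auto intro!: inside_edge.intros(6))
  next
    case 7
    then show ?thesis
      using s r[of m] m by (auto intro!: inside_edge.intros(7))
  next
    case 8
    then show ?thesis
      using s by (auto intro!: inside_edge.intros(8))
  next
    case 9
    then show ?thesis
      using s h[of 0] by (auto intro!: inside_edge.intros(9))
  next
    case 10
    then show ?thesis
      using s h[of m] by (auto intro!: inside_edge.intros(10))
  next
    case 11
    then show ?thesis
      using c[of 0] c[of "Suc 0"] m by (auto intro!: inside_edge.intros(11))
  qed
qed

text \<open>Each of the 11 times 11 pairs of edge families is settled by linear arithmetic: within a
  family, different indices put the edges at least one unit of index apart; for different families
  the constraints are inconsistent.\<close>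

lemma inside_edge_unique:
  assumes e: "inside_edge m i e x y" and f: "inside_edge m j f x y" and m: "m \<ge> 2"
  shows "e = f"
proof -
  note ij = real_index_cases[of i j]
  have m': "2 \<le> real m"
    using m by simp
  show ?thesis
    using e by (cases; use f in \<open>cases; insert ij m'; elim disjE; ((simp; fail) | (rule FalseE, linarith))\<close>)
qed

text \<open>A common point of two edges that is not a vertex lies inside both, which forces them to
  be equal. A common point that is a vertex is an end of both.\<close>

lemma planar_chorded_strip:
  assumes m: "m \<ge> 2"
  shows "planar (chorded_strip m)"
proof -
  let ?G = "chorded_strip m"
  have simple: "e \<subseteq> verts (strip m) \<and> card e = 2" if "e \<in> edges ?G" for e
    using that simple_graph_strip[of m] m by (auto simp: chorded_strip_def simple_graph_def)
  \<comment> \<open>Edges are unordered, so an orientation has to be chosen before a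
    \<open>linepath\<close> can be assigned.\<close>
  define ends where "ends e = (SOME (ab :: nat \<times> nat). e = {fst ab, snd ab})" for e
  have ends: "e = {fst (ends e), snd (ends e)}" if e: "e \<in> edges ?G" for e
  proof -
    obtain a b where "e = {a, b}"
      using simple[OF e] by (metis card_2_iff)
    then have "e = {fst (a, b), snd (a, b)}"
      by simp
    then show ?thesis
      unfolding ends_def by (rule someI)
  qed
  define \<gamma> where "\<gamma> e = linepath (pos m (fst (ends e))) (pos m (snd (ends e)))" for e
  have on: "\<exists>i. on_edge m i e (Re z) (Im z)" if "e \<in> edges ?G" "z \<in> path_image (\<gamma> e)" for e z
    using on_edge_if_in_segment[OF that(1) m ends[OF that(1)]] that(2) by (simp add: \<gamma>_def)
  have vertex: "v \<in> e" if "e \<in> edges ?G" "v \<in> verts (strip m)" "pos m v \<in> path_image (\<gamma> e)" for e v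
    using on[OF that(1,3)] vertex_on_edge that(2) m by blast
  have "plane_drawing ?G (pos m) \<gamma>"
    unfolding plane_drawing_def
  proof (intro conjI ballI impI)
    show "inj_on (pos m) (verts ?G)"
      using inj_on_pos by simp
  next
    fix e assume e: "e \<in> edges ?G"
    obtain a b where ab: "ends e = (a, b)"
      by fastforce
    then have e_eq: "e = {a, b}"
      using ends[OF e] by simp
    then have "a \<noteq> b" "a \<in> verts (strip m)" "b \<in> verts (strip m)"
      using simple[OF e] by auto
    then show "arc (\<gamma> e)"
      unfolding \<gamma>_def ab using inj_on_pos by (intro arc_linepath) (auto dest: inj_onD)
    show "{pathstart (\<gamma> e), pathfinish (\<gamma> e)} = pos m ` e"
      unfolding \<gamma>_def ab by (simp add: e_eq)
    show "v \<in> e" if "v \<in> verts ?G" "pos m v \<in> path_image (\<gamma> e)" for v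
      using vertex e that by simp
  next
    fix e f assume e: "e \<in> edges ?G" and f: "f \<in> edges ?G" and ef: "e \<noteq> f"
    show "path_image (\<gamma> e) \<inter> path_image (\<gamma> f) \<subseteq> pos m ` (e \<inter> f)"
    proof
      fix z assume z: "z \<in> path_image (\<gamma> e) \<inter> path_image (\<gamma> f)"
      then obtain i j where ij: "on_edge m i e (Re z) (Im z)" "on_edge m j f (Re z) (Im z)"
        using on e f by blast
      have "\<exists>v\<in>verts (strip m). pos m v = Complex (Re z) (Im z)"
      proof (rule ccontr)
        assume "\<not> ?thesis"
        then show False
          using inside_edge_unique[OF inside_edge_if_not_vertex[OF ij(1) m] inside_edge_if_not_vertex[OF ij(2) m] m] ef
          by blast
      qed
      then obtain v where v: "v \<in> verts (strip m)" "pos m v = z"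
        by auto
      then show "z \<in> pos m ` (e \<inter> f)"
        using vertex[OF e v(1)] vertex[OF f v(1)] z by blast
    qed
  qed
  then show ?thesis
    by (auto simp: planar_def)
qed

section \<open>The infinite families\<close>

lemma simple_graph_chorded_strip: "m \<ge> 2 \<Longrightarrow> simple_graph (chorded_strip m)"
  using simple_graph_strip[of m] by (auto simp: chorded_strip_def simple_graph_def)

text \<open>Used in both directions: a HIST of a vertex-deleted strip serves the chorded strip too,
  and HIST-freeness descends from the chorded strip to the strip.\<close>

lemma HIST_add_edges:
  "HIST T G \<Longrightarrow> verts H = verts G \<Longrightarrow> edges G \<subseteq> edges H \<Longrightarrow> HIST T H"
  by (auto simp: HIST_def spanning_tree_def)

lemma HIST_critical_chorded_strip:
  assumes "even m" "m \<ge> 4"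
  shows "HIST_critical (chorded_strip m)"
  unfolding HIST_critical_def
proof (intro conjI ballI)
  show "HIST_free (chorded_strip m)"
    by (rule HIST_free_chorded_strip[OF assms])
  fix v assume "v \<in> verts (chorded_strip m)"
  then obtain T where "HIST T (del_verts (strip m) {v})"
    using HIST_del_strip[OF assms] by auto
  then have "HIST T (del_verts (chorded_strip m) {v})"
    by (rule HIST_add_edges) (auto simp: del_verts_def chorded_strip_def)
  then show "\<exists>T. HIST T (del_verts (chorded_strip m) {v})" ..
qed

lemma HIST_critical_strip:
  assumes "even m" "m \<ge> 4"
  shows "HIST_critical (strip m)"
  unfolding HIST_critical_def
proof (intro conjI ballI)
  have "HIST T (chorded_strip m)" if "HIST T (strip m)" for T
    using that by (rule HIST_add_edges) (auto simp: chorded_strip_def)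
  then show "HIST_free (strip m)"
    using HIST_free_chorded_strip[OF assms] unfolding HIST_free_def by blast
qed (rule HIST_del_strip[OF assms])

lemma del_edge_chorded_strip: "del_edge (chorded_strip m) {Mid 0, Mid 1} = strip m"
  using edges_strip(4)[of 0 1 m] by (auto simp: del_edge_def chorded_strip_def)

text \<open>The indices 2k + 4 run through all even \<open>m >= 4\<close>, and the order 3m + 3
  tells the members apart up to isomorphism.\<close>

lemma infinitely_many_chorded_strips:
  assumes "\<And>m. even m \<Longrightarrow> m \<ge> 4 \<Longrightarrow> P (chorded_strip m)"
  shows "infinitely_many_graphs P"
  unfolding infinitely_many_graphs_def
proof (intro exI conjI ballI impI)
  let ?F = "\<lambda>k. chorded_strip (2 * k + 4)"
  have card: "card (verts (chorded_strip m)) = 3 * m + 3" for m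
    using card_verts_strip[of m] by simp
  have "inj ?F"
  proof (rule injI)
    fix k l assume "?F k = ?F l"
    then show "k = l"
      using card[of "2 * k + 4"] card[of "2 * l + 4"] by simp
  qed
  then show "infinite (range ?F)"
    by (rule range_inj_infinite)
  show "simple_graph G" "P G" if "G \<in> range ?F" for G
    using that simple_graph_chorded_strip assms by auto
  fix G H assume "G \<in> range ?F" "H \<in> range ?F" and iso: "graph_iso G H"
  then obtain k l where kl: "G = ?F k" "H = ?F l"
    by blast
  have "card (verts G) = card (verts H)"
    using iso bij_betw_same_card unfolding graph_iso_def by blast
  then show "G = H"
    unfolding kl card by simp
qed

theorem theorem2:
  shows "infinitely_many_graphs (\<lambda>G. planar G \<and> HIST_critical G) \<and>
    infinitely_many_graphs (\<lambda>G. planar G \<and> HIST_critical G \<and>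
      (\<exists>e\<in>edges G. three_connected (del_edge G e) \<and> HIST_critical (del_edge G e)))"
proof (intro conjI infinitely_many_chorded_strips bexI)
  fix m :: nat assume m: "even m" "m \<ge> 4"
  then show "planar (chorded_strip m)"
    by (intro planar_chorded_strip) simp
  \<comment> \<open>The same family witnesses both conjuncts, so planarity and criticality each
    occur twice as goals.\<close>
  then show "planar (chorded_strip m)" .
  show "HIST_critical (chorded_strip m)"
    by (rule HIST_critical_chorded_strip[OF m])
  then show "HIST_critical (chorded_strip m)" .
  show "three_connected (del_edge (chorded_strip m) {Mid 0, Mid 1})"
    using m by (simp only: del_edge_chorded_strip) (intro three_connected_strip, simp)
  show "HIST_critical (del_edge (chorded_strip m) {Mid 0, Mid 1})"
    by (simp only: del_edge_chorded_strip HIST_critical_strip[OF m])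
  show "{Mid 0, Mid 1} \<in> edges (chorded_strip m)"
    by (simp add: chorded_strip_def)
qed

end
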